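(* For every integer $k\geq 1$ there is a graph $G$ such that for every perfect partition $\mathcal{P}$ of $G$, some part of $\mathcal{P}$ contains $K_k$. Moreover, for every integer $t\geq 6$ there is a graph $G$ with tree-width at most $t-1$ (and thus with no $K_{t+1}$-minor) such that for every perfect partition $\mathcal{P}$ of $G$, some part of $\mathcal{P}$ contains a complete graph on at least $\lfloor (\frac{3}{2}t-8)^{1/3}\rfloor$ vertices.
   Context: All graphs are finite, simple and undirected. A graph $G$ contains a graph $H$ if $H$ is isomorphic to an induced subgraph of $G$. A partition of a graph $G$ is a set $\mathcal{P}$ of non-empty induced subgraphs of $G$ such that each vertex of $G$ is in exactly one element of $\mathcal{P}$; each element of $\mathcal{P}$ is called a part. The quotient $G/\mathcal{P}$ is the graph with vertex set $\mathcal{P}$ in which distinct parts $P,Q\in\mathcal{P}$ are adjacent if and only if some vertex in $P$ is adjacent in $G$ to some vertex in $Q$. A partition is connected if each part is a connected graph. A partition is perfect if it is connected and its quotient is a perfect graph (a graph in which every induced subgraph has chromatic number equal to its clique number). $K_n$ denotes the complete graph on $n$ vertices. *)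

theory Defs
  imports Complex_Main "Graph_Theory.Graph_Theory"
begin

text \<open>
  Finite simple undirected graphs are represented by the locale \<open>pair_graph\<close>: finite,
  loop-free digraphs whose arc set is a symmetric set of vertex pairs, an undirected edge \<open>uv\<close>
  being the two arcs \<open>(u, v)\<close> and \<open>(v, u)\<close>.
\<close>

definition complete_graph :: "nat \<Rightarrow> nat pair_pre_digraph" where
  "complete_graph n =
     \<lparr> pverts = {..<n}, parcs = {(u, v). u \<in> {..<n} \<and> v \<in> {..<n} \<and> u \<noteq> v} \<rparr>"

definition contains_graph :: "'a pair_pre_digraph \<Rightarrow> 'b pair_pre_digraph \<Rightarrow> bool" where
  "contains_graph G H \<longleftrightarrow>
     (\<exists>S :: 'a pair_pre_digraph.
        induced_subgraph (with_proj S) (with_proj G) \<and> digraph_iso (with_proj H) (with_proj S))"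

definition graph_partition :: "'a pair_pre_digraph set \<Rightarrow> 'a pair_pre_digraph \<Rightarrow> bool" where
  "graph_partition \<P> G \<longleftrightarrow>
     (\<forall>P\<in>\<P>. induced_subgraph (with_proj P) (with_proj G) \<and> pverts P \<noteq> {}) \<and>
     (\<forall>v\<in>pverts G. \<exists>!P. P \<in> \<P> \<and> v \<in> pverts P)"

definition quotient_graph ::
    "'a pair_pre_digraph \<Rightarrow> 'a pair_pre_digraph set \<Rightarrow> 'a pair_pre_digraph pair_pre_digraph" where
  "quotient_graph G \<P> =
     \<lparr> pverts = \<P>,
       parcs = {(P, Q). P \<in> \<P> \<and> Q \<in> \<P> \<and> P \<noteq> Q \<and>
                  (\<exists>u\<in>pverts P. \<exists>v\<in>pverts Q. (u, v) \<in> parcs G)} \<rparr>"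

definition connected_partition :: "'a pair_pre_digraph set \<Rightarrow> 'a pair_pre_digraph \<Rightarrow> bool" where
  "connected_partition \<P> G \<longleftrightarrow>
     graph_partition \<P> G \<and> (\<forall>P\<in>\<P>. Digraph_Component.connected (with_proj P))"

definition proper_colouring :: "'a pair_pre_digraph \<Rightarrow> nat \<Rightarrow> ('a \<Rightarrow> nat) \<Rightarrow> bool" where
  "proper_colouring G c f \<longleftrightarrow>
     f ` pverts G \<subseteq> {..<c} \<and> (\<forall>(u, v)\<in>parcs G. f u \<noteq> f v)"

definition chromatic_number :: "'a pair_pre_digraph \<Rightarrow> nat" where
  "chromatic_number G = (LEAST c. \<exists>f. proper_colouring G c f)"

definition clique_number :: "'a pair_pre_digraph \<Rightarrow> nat" where
  "clique_number G = Max {n. contains_graph G (complete_graph n)}"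

definition perfect_graph :: "'a pair_pre_digraph \<Rightarrow> bool" where
  "perfect_graph G \<longleftrightarrow>
     (\<forall>H :: 'a pair_pre_digraph. induced_subgraph (with_proj H) (with_proj G) \<longrightarrow>
        chromatic_number H = clique_number H)"

definition perfect_partition :: "'a pair_pre_digraph set \<Rightarrow> 'a pair_pre_digraph \<Rightarrow> bool" where
  "perfect_partition \<P> G \<longleftrightarrow>
     connected_partition \<P> G \<and> perfect_graph (quotient_graph G \<P>)"

text \<open>
  The constant \<open>tree\<close> of the graph library is not usable for undirected trees: there the closed
  walk \<open>u, v, u\<close> along a single edge of a symmetric digraph counts as a cycle.  In a simple
  undirected graph the cycles are exactly the library's cycles of length at least 3.
\<close>

definition undirected_tree :: "'a pair_pre_digraph \<Rightarrow> bool" where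
  "undirected_tree T \<longleftrightarrow>
     pair_graph T \<and> Digraph_Component.connected (with_proj T) \<and>
     \<not> (\<exists>p. pre_digraph.cycle (with_proj T) p \<and> 3 \<le> length p)"

text \<open>
  The library's \<open>connected\<close> includes non-emptiness of the vertex set, so the last condition below
  also says that every vertex lies in some bag.
\<close>

definition tree_decomposition ::
    "'a pair_pre_digraph \<Rightarrow> 'b pair_pre_digraph \<Rightarrow> ('b \<Rightarrow> 'a set) \<Rightarrow> bool" where
  "tree_decomposition G T B \<longleftrightarrow>
     undirected_tree T \<and>
     (\<forall>x\<in>pverts T. B x \<subseteq> pverts G) \<and>
     (\<forall>(u, v)\<in>parcs G. \<exists>x\<in>pverts T. u \<in> B x \<and> v \<in> B x) \<and>
     (\<forall>v\<in>pverts G. Digraph_Component.connected (with_proj T \<restriction> {x \<in> pverts T. v \<in> B x}))"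

definition decomposition_width :: "'b pair_pre_digraph \<Rightarrow> ('b \<Rightarrow> 'a set) \<Rightarrow> nat" where
  "decomposition_width T B = Max ((\<lambda>x. card (B x)) ` pverts T) - 1"

text \<open>
  Every finite tree is isomorphic to one on natural numbers, so restricting the index trees to
  \<open>nat\<close> is harmless.  Because of truncated subtraction, the graph without vertices gets
  tree-width 0 instead of -1; all other graphs get the usual value.
\<close>

definition tree_width :: "'a pair_pre_digraph \<Rightarrow> nat" where
  "tree_width G =
     (LEAST w. \<exists>(T :: nat pair_pre_digraph) B.
        tree_decomposition G T B \<and> decomposition_width T B = w)"

text \<open>\<open>M x\<close> is the branch set of the vertex \<open>x\<close> of \<open>H\<close>.\<close>

definition has_minor :: "'a pair_pre_digraph \<Rightarrow> 'b pair_pre_digraph \<Rightarrow> bool" where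
  "has_minor G H \<longleftrightarrow>
     (\<exists>M :: 'b \<Rightarrow> 'a set.
        (\<forall>x\<in>pverts H. M x \<subseteq> pverts G \<and> Digraph_Component.connected (with_proj G \<restriction> M x)) \<and>
        (\<forall>x\<in>pverts H. \<forall>y\<in>pverts H. x \<noteq> y \<longrightarrow> M x \<inter> M y = {}) \<and>
        (\<forall>(x, y)\<in>parcs H. \<exists>u\<in>M x. \<exists>v\<in>M y. (u, v) \<in> parcs G))"

end

theory Submission
  imports Defs
begin

text \<open>
  Every graph below lives on an initial segment \<open>{..<n}\<close> of the naturals, and a partition is handled
  through the labelling that sends each vertex to its part.  Perfection of the quotient is used only
  through one consequence: the quotient has no induced cycle of length five
  (\<open>perfect_graph_no_pentagon\<close>).  Call a labelling good if its fibres are connected and its quotient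
  has this property.

  The graphs are built by attaching gadgets along cliques.  If every vertex outside \<open>B\<close> sees
  \<open>B\<close> only within one clique, and adjacent outside vertices share that clique, then a walk of a part
  that leaves \<open>B\<close> can be shortcut inside the clique.  Hence a good labelling of the whole graph
  restricts to a good labelling of \<open>B\<close> (\<open>good_labelling_base\<close>), and whatever \<open>B\<close> forces on
  partitions is still forced in the larger graph.

  Suppose that \<open>A\<close> forces a monochromatic \<open>k\<close>-clique, that is, a clique of \<open>k\<close> vertices in one part.
  Two constructions lead to a graph forcing a monochromatic \<open>(k+1)\<close>-clique.

  \<^item> From a graph \<open>B\<close> that forces a clique meeting \<open>r\<close> parts in exactly \<open>k\<close> vertices each (or else a
    monochromatic \<open>(k+1)\<close>-clique), \<open>forces_uniform_Suc\<close> makes one for \<open>r + 1\<close>: each clique of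
    \<open>k r\<close> vertices of \<open>B\<close> receives a new copy of \<open>A\<close> that is complete to it.  The copy over the forced
    clique \<open>C\<close> cannot use a label of \<open>C\<close>, since the new vertex would extend the \<open>k\<close> vertices of that
    label.  So the copy is partitioned on its own, and its monochromatic \<open>k\<close>-clique becomes the label number \<open>r + 1\<close>.

  \<^item> For \<open>r = 2k\<close>, \<open>forces_clique_Suc\<close> attaches two \<open>(k+1)\<close>-cliques with exactly one common vertex \<open>y\<close>,
    each of the \<open>2k\<close> other vertices complete to its own label class of \<open>C\<close>.  If neither clique
    is monochromatic, both contain a vertex, \<open>x\<close> and \<open>x'\<close>, whose label differs from that of \<open>y\<close>.
    The labels of \<open>x\<close>, \<open>y\<close>, \<open>x'\<close> and of the two classes attached to \<open>x\<close> and \<open>x'\<close> then form an induced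
    five-cycle in the quotient.

  Tree-width is tracked by elimination orders: the graph is a spanning subgraph of a graph \<open>H\<close> in which
  the earlier neighbours of each vertex form a clique with fewer than \<open>s\<close> elements.  Both constructions
  respect such orders, and the resulting bound is \<open>3 s \<le> 2 k\<^sup>3 + 16\<close> (\<open>clique_forcing_graph\<close>).
  An elimination order yields a tree decomposition of width at most \<open>s - 1\<close> (\<open>thin_tree_width\<close>), and
  deleting the last vertex repeatedly shows that no clique minor has more than \<open>s\<close> vertices
  (\<open>no_large_clique_minor\<close>).
\<close>

section \<open>Connected sets and cliques\<close>

definition joined_in :: "'a set \<Rightarrow> ('a \<Rightarrow> 'a \<Rightarrow> bool) \<Rightarrow> 'a \<Rightarrow> 'a \<Rightarrow> bool" where
  "joined_in S E = (\<lambda>x y. x \<in> S \<and> y \<in> S \<and> E x y)\<^sup>*\<^sup>*"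

definition connected_in :: "'a set \<Rightarrow> ('a \<Rightarrow> 'a \<Rightarrow> bool) \<Rightarrow> bool" where
  "connected_in S E \<longleftrightarrow> (\<forall>u\<in>S. \<forall>v\<in>S. joined_in S E u v)"

definition clique :: "('a \<Rightarrow> 'a \<Rightarrow> bool) \<Rightarrow> 'a set \<Rightarrow> bool" where
  "clique E S \<longleftrightarrow> (\<forall>u\<in>S. \<forall>v\<in>S. u \<noteq> v \<longrightarrow> E u v)"

lemma joined_in_refl: "joined_in S E u u"
  by (simp add: joined_in_def)

lemma joined_in_step:
  "joined_in S E u x \<Longrightarrow> x \<in> S \<Longrightarrow> y \<in> S \<Longrightarrow> x = y \<or> E x y \<Longrightarrow> joined_in S E u y"
  unfolding joined_in_def by (auto intro: rtranclp.rtrancl_into_rtrancl)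

lemma joined_in_trans: "joined_in S E u v \<Longrightarrow> joined_in S E v w \<Longrightarrow> joined_in S E u w"
  unfolding joined_in_def by (rule rtranclp_trans)

lemma joined_in_edge: "x \<in> S \<Longrightarrow> y \<in> S \<Longrightarrow> E x y \<Longrightarrow> joined_in S E x y"
  by (blast intro: joined_in_step joined_in_refl)

lemma joined_in_sym:
  assumes "joined_in S E u v" and "\<And>x y. x \<in> S \<Longrightarrow> y \<in> S \<Longrightarrow> E x y \<Longrightarrow> E y x"
  shows "joined_in S E v u"
  using assms(1) unfolding joined_in_def
proof (induction rule: rtranclp_induct)
  case (step y z)
  then have "z \<in> S \<and> y \<in> S \<and> E z y" using assms(2) by blast
  with step.IH show ?case by (blast intro: converse_rtranclp_into_rtranclp)
qed simp

lemma connected_in_induct [consumes 3, case_names start step]: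
  assumes "connected_in S E" "u \<in> S" "z \<in> S"
    and "P u"
    and "\<And>x y. x \<in> S \<Longrightarrow> y \<in> S \<Longrightarrow> E x y \<Longrightarrow> P x \<Longrightarrow> P y"
  shows "P z"
proof -
  have "joined_in S E u z" using assms(1-3) by (simp add: connected_in_def)
  then show ?thesis unfolding joined_in_def
    by (induction rule: rtranclp_induct) (auto intro: assms(4,5))
qed

lemma connected_in_subset_closed:
  assumes "connected_in S E" "u \<in> S" "u \<in> D"
    and "\<And>x y. x \<in> S \<Longrightarrow> y \<in> S \<Longrightarrow> E x y \<Longrightarrow> x \<in> D \<Longrightarrow> y \<in> D"
  shows "S \<subseteq> D"
proof
  fix z assume "z \<in> S"
  with assms(1,2) show "z \<in> D" by (induction rule: connected_in_induct) (use assms in auto)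
qed

lemma connected_in_cong:
  assumes "\<And>x y. x \<in> S \<Longrightarrow> y \<in> S \<Longrightarrow> E x y \<longleftrightarrow> E' x y"
  shows "connected_in S E \<longleftrightarrow> connected_in S E'"
proof -
  have "(\<lambda>x y. x \<in> S \<and> y \<in> S \<and> E x y) = (\<lambda>x y. x \<in> S \<and> y \<in> S \<and> E' x y)"
    using assms by blast
  then show ?thesis by (simp add: connected_in_def joined_in_def)
qed

lemma clique_subset: "clique E S \<Longrightarrow> T \<subseteq> S \<Longrightarrow> clique E T"
  by (auto simp: clique_def)

section \<open>Attaching along cliques\<close>

text \<open>
  Outside \<open>B\<close> the map \<open>own\<close> is constant on components, so that each component of \<open>V - B\<close> is attached
  to a single clique of \<open>B\<close>.
\<close>

locale clique_attachment =
  fixes V B :: "'a set" and E :: "'a \<Rightarrow> 'a \<Rightarrow> bool" and own :: "'a \<Rightarrow> 'a set"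
  assumes base_subset: "B \<subseteq> V"
    and own_subset: "w \<in> V - B \<Longrightarrow> own w \<subseteq> B"
    and own_clique: "w \<in> V - B \<Longrightarrow> clique E (own w)"
    and own_eq: "w \<in> V - B \<Longrightarrow> w' \<in> V - B \<Longrightarrow> E w w' \<Longrightarrow> own w = own w'"
    and in_own: "b \<in> B \<Longrightarrow> w \<in> V - B \<Longrightarrow> E b w \<Longrightarrow> b \<in> own w"
    and sym: "x \<in> V \<Longrightarrow> y \<in> V \<Longrightarrow> E x y \<Longrightarrow> E y x"
begin

text \<open>
  Following a walk of \<open>S\<close> that starts in \<open>B\<close>: while it is outside \<open>B\<close>, remember the vertex \<open>c\<close> of the
  attaching clique through which it left.  It can come back only into the same clique, where \<open>c\<close> is
  adjacent to the point of return.
\<close>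

lemma joined_in_base:
  assumes "connected_in S E" "S \<subseteq> V" "u \<in> S" "u \<in> B" "z \<in> S"
  shows "if z \<in> B then joined_in (S \<inter> B) E u z
         else \<exists>c\<in>S \<inter> own z. joined_in (S \<inter> B) E u c"
  using assms(1,3,5)
proof (induction rule: connected_in_induct)
  case start
  then show ?case using assms by (simp add: joined_in_refl)
next
  case (step x y)
  have V: "x \<in> V" "y \<in> V" using step assms(2) by auto
  have yx: "E y x" using sym V step by blast
  show ?case
  proof (cases "x \<in> B")
    case x: True
    then have j: "joined_in (S \<inter> B) E u x" using step by simp
    show ?thesis
    proof (cases "y \<in> B")
      case True
      then show ?thesis using j x step by (auto intro: joined_in_step)
    next
      case False
      then have "x \<in> own y" using x V step in_own by auto
      then show ?thesis using j False step by auto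
    qed
  next
    case x: False
    then obtain c where c: "c \<in> S" "c \<in> own x" "joined_in (S \<inter> B) E u c" using step by auto
    have cB: "c \<in> B" using own_subset V x c by blast
    show ?thesis
    proof (cases "y \<in> B")
      case True
      then have "y \<in> own x" using yx V x in_own by auto
      then have "c = y \<or> E c y" using own_clique[of x] V x c by (auto simp: clique_def)
      then show ?thesis using True c cB step by (auto intro: joined_in_step)
    next
      case False
      then have "own x = own y" using own_eq V x step by blast
      then show ?thesis using False c by auto
    qed
  qed
qed

lemma connected_in_base:
  assumes "connected_in S E" "S \<subseteq> V"
  shows "connected_in (S \<inter> B) E"
  unfolding connected_in_def
proof (intro ballI)
  fix u v assume "u \<in> S \<inter> B" "v \<in> S \<inter> B"
  then show "joined_in (S \<inter> B) E u v" using joined_in_base[OF assms, of u v] by simp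
qed

lemma meets_own:
  assumes "connected_in S E" "S \<subseteq> V" "S \<inter> B \<noteq> {}" "z \<in> S" "z \<notin> B"
  shows "S \<inter> own z \<noteq> {}"
  using joined_in_base[OF assms(1,2) _ _ assms(4)] assms by auto

lemma adjacent_in_base:
  assumes S: "connected_in S E" "S \<subseteq> V" "S \<inter> B \<noteq> {}"
    and T: "connected_in T E" "T \<subseteq> V" "T \<inter> B \<noteq> {}"
    and "S \<inter> T = {}" "x \<in> S" "y \<in> T" "E x y"
  shows "\<exists>x'\<in>S \<inter> B. \<exists>y'\<in>T \<inter> B. E x' y'"
proof -
  have V: "x \<in> V" "y \<in> V" using assms by auto
  have yx: "E y x" using sym V assms by blast
  \<comment> \<open>An end of the edge outside \<open>B\<close> leads both sets to the clique to which that end is attached.\<close>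
  have "\<exists>K \<subseteq> B. clique E K \<and> S \<inter> K \<noteq> {} \<and> T \<inter> K \<noteq> {}" if "x \<notin> B \<or> y \<notin> B"
  proof (cases "x \<in> B")
    case True
    then have y: "y \<notin> B" using that by simp
    then have "x \<in> own y" using True V assms in_own by auto
    then show ?thesis
      using own_subset[of y] own_clique[of y] meets_own[OF T \<open>y \<in> T\<close> y] V y \<open>x \<in> S\<close> by blast
  next
    case x: False
    have "T \<inter> own x \<noteq> {}"
    proof (cases "y \<in> B")
      case True
      then have "y \<in> own x" using x V yx in_own by auto
      then show ?thesis using \<open>y \<in> T\<close> by auto
    next
      case False
      then have "own x = own y" using own_eq V x assms by blast
      then show ?thesis using meets_own[OF T \<open>y \<in> T\<close> False] by simp
    qed
    then show ?thesis
      using own_subset[of x] own_clique[of x] meets_own[OF S \<open>x \<in> S\<close> x] V x by blast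
  qed
  then show ?thesis
  proof (cases "x \<in> B \<and> y \<in> B")
    case True
    then show ?thesis using assms by blast
  next
    case False
    then obtain K where K: "K \<subseteq> B" "clique E K" "S \<inter> K \<noteq> {}" "T \<inter> K \<noteq> {}"
      using \<open>x \<notin> B \<or> y \<notin> B \<Longrightarrow> _\<close> by auto
    then obtain a b where ab: "a \<in> S" "a \<in> K" "b \<in> T" "b \<in> K" by blast
    then have "a \<noteq> b" using \<open>S \<inter> T = {}\<close> by auto
    then have "E a b" using K(2) ab by (simp add: clique_def)
    then show ?thesis using ab K(1) by blast
  qed
qed

end

section \<open>Good labellings\<close>

definition fibre :: "'a set \<Rightarrow> ('a \<Rightarrow> 'b) \<Rightarrow> 'b \<Rightarrow> 'a set" where
  "fibre V f c = {v \<in> V. f v = c}"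

text \<open>For distinct labels this is adjacency in the quotient.\<close>

definition touches :: "'a set \<Rightarrow> ('a \<Rightarrow> 'a \<Rightarrow> bool) \<Rightarrow> ('a \<Rightarrow> 'b) \<Rightarrow> 'b \<Rightarrow> 'b \<Rightarrow> bool" where
  "touches V E f c d \<longleftrightarrow> (\<exists>u\<in>fibre V f c. \<exists>v\<in>fibre V f d. E u v)"

text \<open>
  An induced five-cycle.  The ten conditions list each pair of labels in one order only, because the
  relations in question are symmetric.
\<close>

definition pentagon :: "('b \<Rightarrow> 'b \<Rightarrow> bool) \<Rightarrow> 'b \<Rightarrow> 'b \<Rightarrow> 'b \<Rightarrow> 'b \<Rightarrow> 'b \<Rightarrow> bool" where
  "pentagon R a b c d e \<longleftrightarrow>
     distinct [a, b, c, d, e] \<and> R a b \<and> R b c \<and> R c d \<and> R d e \<and> R e a \<and>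
     \<not> R a c \<and> \<not> R a d \<and> \<not> R b d \<and> \<not> R b e \<and> \<not> R c e"

definition good_labelling :: "'a set \<Rightarrow> ('a \<Rightarrow> 'a \<Rightarrow> bool) \<Rightarrow> ('a \<Rightarrow> 'b) \<Rightarrow> bool" where
  "good_labelling V E f \<longleftrightarrow>
     (\<forall>c. connected_in (fibre V f c) E) \<and>
     (\<nexists>a b c d e. pentagon (touches V E f) a b c d e)"

lemma pentagon_transfer:
  assumes "pentagon R a b c d e"
    and "\<And>x y. R x y \<Longrightarrow> x \<in> L \<and> y \<in> L"
    and "\<And>x y. x \<in> L \<Longrightarrow> y \<in> L \<Longrightarrow> x \<noteq> y \<Longrightarrow> R' x y \<longleftrightarrow> R x y"
  shows "pentagon R' a b c d e"
proof -
  have "{a, b, c, d, e} \<subseteq> L" using assms(1,2) unfolding pentagon_def by blast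
  then show ?thesis using assms(1,3) unfolding pentagon_def by auto
qed

lemma touches_labels: "touches V E f c d \<Longrightarrow> c \<in> f ` V \<and> d \<in> f ` V"
  by (auto simp: touches_def fibre_def)

lemma good_labelling_cong:
  assumes "\<And>u v. u \<in> V \<Longrightarrow> v \<in> V \<Longrightarrow> E u v \<longleftrightarrow> E' u v"
  shows "good_labelling V E f \<longleftrightarrow> good_labelling V E' f"
proof -
  have "connected_in (fibre V f c) E \<longleftrightarrow> connected_in (fibre V f c) E'" for c
    using assms by (intro connected_in_cong) (auto simp: fibre_def)
  moreover have "touches V E f = touches V E' f"
    using assms by (auto simp: touches_def fibre_def fun_eq_iff)
  ultimately show ?thesis by (simp add: good_labelling_def)
qed

text \<open>
  By the shortcut argument the fibres stay connected, and two distinct labels that occur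
  in \<open>B\<close> touch in \<open>V\<close> only if they touch in \<open>B\<close>.  So the quotient of \<open>B\<close> is an induced subgraph of the quotient
  of \<open>V\<close>.
\<close>

lemma (in clique_attachment) good_labelling_base:
  assumes "good_labelling V E f"
  shows "good_labelling B E f"
proof -
  have conn: "connected_in (fibre V f c) E" for c
    using assms by (simp add: good_labelling_def)
  have fib: "fibre B f c = fibre V f c \<inter> B" for c
    using base_subset by (auto simp: fibre_def)
  have sub: "fibre V f c \<subseteq> V" for c by (auto simp: fibre_def)
  have eq: "touches V E f c d \<longleftrightarrow> touches B E f c d"
    if "c \<in> f ` B" "d \<in> f ` B" "c \<noteq> d" for c d
  proof
    assume "touches V E f c d"
    then obtain x y where "x \<in> fibre V f c" "y \<in> fibre V f d" "E x y"
      by (auto simp: touches_def)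
    moreover have "fibre V f c \<inter> B \<noteq> {}" "fibre V f d \<inter> B \<noteq> {}"
      using that base_subset by (auto simp: fibre_def)
    moreover have "fibre V f c \<inter> fibre V f d = {}" using \<open>c \<noteq> d\<close> by (auto simp: fibre_def)
    ultimately show "touches B E f c d"
      using adjacent_in_base[OF conn sub _ conn sub] fib by (force simp: touches_def)
  qed (auto simp: touches_def fib)
  have "pentagon (touches V E f) a b c d e" if "pentagon (touches B E f) a b c d e" for a b c d e
    using that by (rule pentagon_transfer[where L = "f ` B"]) (use touches_labels eq in metis)+
  then show ?thesis
    using assms connected_in_base[OF conn sub] fib by (auto simp: good_labelling_def)
qed

section \<open>Elimination orders and attached copies\<close>

definition graph_on :: "nat \<Rightarrow> (nat \<Rightarrow> nat \<Rightarrow> bool) \<Rightarrow> bool" where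
  "graph_on n E \<longleftrightarrow> (\<forall>u<n. \<forall>v<n. E u v \<longrightarrow> u \<noteq> v \<and> E v u)"

definition earlier :: "(nat \<Rightarrow> nat \<Rightarrow> bool) \<Rightarrow> nat \<Rightarrow> nat set" where
  "earlier H v = {u. u < v \<and> H u v}"

text \<open>
  The natural order of the vertices is a perfect elimination order of \<open>H\<close>: removing
  vertices from the last to the first always removes a vertex whose neighbourhood is a clique.
\<close>

definition elimination :: "nat \<Rightarrow> nat \<Rightarrow> (nat \<Rightarrow> nat \<Rightarrow> bool) \<Rightarrow> bool" where
  "elimination n s H \<longleftrightarrow>
     graph_on n H \<and> (\<forall>v<n. clique H (earlier H v) \<and> card (earlier H v) < s)"

text \<open>For \<open>s > 0\<close> this certifies tree-width at most \<open>s - 1\<close>.\<close>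

definition thin :: "nat \<Rightarrow> nat \<Rightarrow> (nat \<Rightarrow> nat \<Rightarrow> bool) \<Rightarrow> bool" where
  "thin n s E \<longleftrightarrow>
     graph_on n E \<and> (\<exists>H. elimination n s H \<and> (\<forall>u<n. \<forall>v<n. E u v \<longrightarrow> H u v))"

text \<open>
  The vertices \<open>n, n + 1, \<dots>\<close> are cut into blocks of length \<open>m\<close>, and block \<open>i\<close> carries a copy of \<open>A\<close>
  whose vertex \<open>a\<close> is joined to the set \<open>D i a\<close> of old vertices.  New vertices come after
  all old ones, so the natural order can remain an elimination order.
\<close>

definition glue ::
    "nat \<Rightarrow> (nat \<Rightarrow> nat \<Rightarrow> bool) \<Rightarrow> nat \<Rightarrow> (nat \<Rightarrow> nat \<Rightarrow> bool) \<Rightarrow> (nat \<Rightarrow> nat \<Rightarrow> nat set) \<Rightarrow>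
      nat \<Rightarrow> nat \<Rightarrow> bool" where
  "glue n E m A D u v \<longleftrightarrow>
     (if u < n then
        if v < n then E u v else u \<in> D ((v - n) div m) ((v - n) mod m)
      else
        if v < n then v \<in> D ((u - n) div m) ((u - n) mod m)
        else (u - n) div m = (v - n) div m \<and> A ((u - n) mod m) ((v - n) mod m))"

lemma finite_earlier [simp]: "finite (earlier H v)"
  by (rule finite_subset[of _ "{..<v}"]) (auto simp: earlier_def)

lemma copy_cases:
  fixes n m L w :: nat
  assumes "n \<le> w" "w < n + L * m"
  obtains i a where "i < L" "a < m" "w = n + i * m + a" "(w - n) div m = i" "(w - n) mod m = a"
proof -
  have m: "m > 0" using assms by (cases m) auto
  show thesis
  proof
    show "(w - n) div m < L" using assms m by (simp add: less_mult_imp_div_less)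
    show "(w - n) mod m < m" using m by simp
    show "w = n + (w - n) div m * m + (w - n) mod m"
      using assms by (metis add.assoc div_mult_mod_eq le_add_diff_inverse)
  qed auto
qed

lemma glue_simps:
  assumes "a < m"
  shows "u < n \<Longrightarrow> glue n E m A D u (n + i * m + a) \<longleftrightarrow> u \<in> D i a"
    and "u < n \<Longrightarrow> glue n E m A D (n + i * m + a) u \<longleftrightarrow> u \<in> D i a"
    and "b < m \<Longrightarrow> glue n E m A D (n + i * m + a) (n + j * m + b) \<longleftrightarrow> i = j \<and> A a b"
  using assms by (simp_all add: glue_def add.assoc)

lemma graph_on_glue:
  assumes "graph_on n E" "graph_on m A"
  shows "graph_on (n + L * m) (glue n E m A D)"
  unfolding graph_on_def
proof (intro allI impI)
  fix u v assume uv: "u < n + L * m" "v < n + L * m" "glue n E m A D u v"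
  show "u \<noteq> v \<and> glue n E m A D v u"
  proof (cases "u < n")
    case u: True
    show ?thesis
    proof (cases "v < n")
      case True
      then have "E u v" using u uv(3) by (simp add: glue_def)
      then have "u \<noteq> v \<and> E v u" using assms(1) u True unfolding graph_on_def by blast
      then show ?thesis using u True by (simp add: glue_def)
    next
      case False
      then show ?thesis using u uv(3) by (simp add: glue_def)
    qed
  next
    case u: False
    then obtain i a where ia: "i < L" "a < m" "u = n + i * m + a" using copy_cases uv by (metis not_le)
    show ?thesis
    proof (cases "v < n")
      case True
      then show ?thesis using u uv(3) by (simp add: glue_def)
    next
      case False
      then obtain j b where jb: "j < L" "b < m" "v = n + j * m + b" using copy_cases uv by (metis not_le)
      have "i = j" "A a b" using uv(3) ia jb by (simp_all add: glue_simps)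
      then have "a \<noteq> b \<and> A b a" using assms(2) ia(2) jb(2) unfolding graph_on_def by blast
      then show ?thesis using ia jb \<open>i = j\<close> glue_simps(3)[of b m a] by simp
    qed
  qed
qed

text \<open>
  In the chordal supergraph every copy is complete to its clique \<open>C i\<close>.  The earlier neighbours of
  a copied vertex are then \<open>C i\<close> together with the copies of its earlier neighbours in \<open>A\<close>.
\<close>

lemma elimination_glue:
  assumes E: "elimination n s E" and A: "elimination m r A"
    and D: "\<And>i. i < L \<Longrightarrow> C i \<subseteq> {..<n} \<and> clique E (C i) \<and> card (C i) \<le> q"
  shows "elimination (n + L * m) (max s (q + r)) (glue n E m A (\<lambda>i a. C i))"
proof -
  let ?G = "glue n E m A (\<lambda>i a. C i)"
  have "clique ?G (earlier ?G v) \<and> card (earlier ?G v) < max s (q + r)" if v: "v < n + L * m" for v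
  proof (cases "v < n")
    case True
    then have "earlier ?G v = earlier E v" by (auto simp: earlier_def glue_def)
    moreover have "clique ?G (earlier E v)"
      using E True by (auto simp: elimination_def clique_def earlier_def glue_def)
    ultimately show ?thesis using E True by (auto simp: elimination_def)
  next
    case False
    then obtain i a where ia: "i < L" "a < m" "v = n + i * m + a" using copy_cases v by (metis not_le)
    let ?h = "\<lambda>b. n + i * m + b"
    have eq: "earlier ?G v = C i \<union> ?h ` earlier A a"
    proof (intro set_eqI iffI)
      fix u assume "u \<in> earlier ?G v"
      then have u: "u < v" "?G u v" by (auto simp: earlier_def)
      show "u \<in> C i \<union> ?h ` earlier A a"
      proof (cases "u < n")
        case True
        then show ?thesis using u ia by (simp add: glue_simps)
      next
        case False
        then obtain j b where jb: "j < L" "b < m" "u = n + j * m + b"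
          using copy_cases u v by (metis not_le order.strict_trans)
        then have "j = i" "A b a" using u ia by (simp_all add: glue_simps)
        then show ?thesis using jb u ia by (auto simp: earlier_def)
      qed
    next
      fix u assume "u \<in> C i \<union> ?h ` earlier A a"
      then consider "u \<in> C i" | b where "b < a" "A b a" "u = ?h b" by (auto simp: earlier_def)
      then show "u \<in> earlier ?G v"
      proof cases
        case 1
        then have "u < n" using D ia by auto
        then show ?thesis using 1 ia by (auto simp: earlier_def glue_simps)
      next
        case 2
        then show ?thesis using ia by (auto simp: earlier_def glue_simps)
      qed
    qed
    have clA: "clique A (earlier A a)" "card (earlier A a) < r"
      using A ia by (auto simp: elimination_def)
    have Ci: "C i \<subseteq> {..<n}" "clique E (C i)" "card (C i) \<le> q" using D ia by auto
    have lt: "b < m" if "b \<in> earlier A a" for b using that ia by (auto simp: earlier_def)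
    have "clique ?G (earlier ?G v)"
      unfolding eq clique_def
    proof (intro ballI impI)
      fix x y assume xy: "x \<in> C i \<union> ?h ` earlier A a" "y \<in> C i \<union> ?h ` earlier A a" "x \<noteq> y"
      show "?G x y"
      proof (cases "x \<in> C i")
        case x: True
        show ?thesis
        proof (cases "y \<in> C i")
          case True
          then show ?thesis using x xy Ci by (auto simp: glue_def clique_def)
        next
          case False
          then obtain b where "b < m" "y = ?h b" using xy lt by auto
          then show ?thesis using x Ci glue_simps(1)[of b m x n] by auto
        qed
      next
        case False
        then obtain b where b: "b < m" "b \<in> earlier A a" "x = ?h b" using xy lt by auto
        show ?thesis
        proof (cases "y \<in> C i")
          case True
          then show ?thesis using b Ci glue_simps(2)[of b m y n] by auto
        next
          case False
          then obtain b' where b': "b' < m" "b' \<in> earlier A a" "y = ?h b'" using xy lt by auto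
          then show ?thesis using b clA xy glue_simps(3)[of b m b'] by (auto simp: clique_def)
        qed
      qed
    qed
    moreover have "card (earlier ?G v) \<le> card (C i) + card (?h ` earlier A a)"
      unfolding eq by (rule card_Un_le)
    moreover have "card (?h ` earlier A a) \<le> card (earlier A a)" by (rule card_image_le) simp
    ultimately show ?thesis using clA Ci by linarith
  qed
  then show ?thesis
    using graph_on_glue E A by (auto simp: elimination_def)
qed

text \<open>
  One copy of \<open>A\<close>, placed at \<open>p, \<dots>, p + m - 1\<close>, seen from outside: its only neighbours are
  the prescribed sets \<open>d a\<close> of old vertices.
\<close>

locale attached_copy =
  fixes N n m p :: nat and E A :: "nat \<Rightarrow> nat \<Rightarrow> bool" and d :: "nat \<Rightarrow> nat set"
  assumes graph: "graph_on N E"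
    and base_le: "n \<le> p" "p + m \<le> N"
    and copy_edge: "\<And>a b. a < m \<Longrightarrow> b < m \<Longrightarrow> E (p + a) (p + b) \<longleftrightarrow> A a b"
    and copy_link: "\<And>a u. a < m \<Longrightarrow> u < n \<Longrightarrow> E u (p + a) \<longleftrightarrow> u \<in> d a"
    and copy_neighbour: "\<And>a w. a < m \<Longrightarrow> w < N \<Longrightarrow> n \<le> w \<Longrightarrow> E w (p + a) \<Longrightarrow> p \<le> w \<and> w < p + m"

text \<open>
  The clique that a labelling singles out, and the way in which its vertices are labelled, are unknown
  when the graph is built.  Therefore a copy is attached along every pattern \<open>d\<close> whose sets unite to a
  clique of at most \<open>q\<close> vertices; there are only finitely many.
\<close>

lemma attach_copies:
  assumes E: "thin n s E" and A: "thin m r A"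
  obtains N E' own where
    "thin N (max s (q + r)) E'" "n \<le> N" "\<And>u v. u < n \<Longrightarrow> v < n \<Longrightarrow> E' u v = E u v"
    "clique_attachment {..<N} {..<n} E' own"
    "\<And>d. (\<Union>a<m. d a) \<subseteq> {..<n} \<Longrightarrow> clique E (\<Union>a<m. d a) \<Longrightarrow> card (\<Union>a<m. d a) \<le> q \<Longrightarrow>
       \<exists>p. attached_copy N n m p E' A d"
proof -
  \<comment> \<open>Patterns are empty beyond \<open>m\<close>, which makes their number finite.\<close>
  define Ps where "Ps = {d. (\<forall>a. (a \<in> {..<m} \<longrightarrow> d a \<in> Pow {..<n}) \<and> (a \<notin> {..<m} \<longrightarrow> d a = {})) \<and>
    clique E (\<Union>a<m. d a) \<and> card (\<Union>a<m. d a) \<le> q}"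
  have "finite Ps"
    unfolding Ps_def
    by (rule finite_subset[OF _ finite_set_of_finite_funs[of "{..<m}" "Pow {..<n}" "{}"]]) auto
  then obtain xs where xs: "set xs = Ps" using finite_list by blast
  define L where "L = length xs"
  define D where "D i = xs ! i" for i
  define C where "C i = (\<Union>a<m. D i a)" for i
  define N where "N = n + L * m"
  define E' where "E' = glue n E m A D"
  have DPs: "D i \<in> Ps" if "i < L" for i using that xs by (auto simp: L_def D_def)
  have C: "C i \<subseteq> {..<n} \<and> clique E (C i) \<and> card (C i) \<le> q" if "i < L" for i
    using DPs[OF that] by (auto simp: Ps_def C_def)
  have DC: "D i a \<subseteq> C i" if "a < m" for i a using that by (auto simp: C_def)
  have gE: "graph_on n E" "graph_on m A" using E A by (auto simp: thin_def)
  have gE': "graph_on N E'" unfolding N_def E'_def by (rule graph_on_glue[OF gE])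
  obtain HE where HE: "elimination n s HE" "\<And>u v. u < n \<Longrightarrow> v < n \<Longrightarrow> E u v \<Longrightarrow> HE u v"
    using E by (auto simp: thin_def)
  obtain HA where HA: "elimination m r HA" "\<And>u v. u < m \<Longrightarrow> v < m \<Longrightarrow> A u v \<Longrightarrow> HA u v"
    using A by (auto simp: thin_def)
  let ?H = "glue n HE m HA (\<lambda>i a. C i)"
  have "elimination N (max s (q + r)) ?H"
    unfolding N_def
  proof (rule elimination_glue[OF HE(1) HA(1)])
    fix i assume "i < L"
    then have "C i \<subseteq> {..<n}" "clique E (C i)" "card (C i) \<le> q" using C by auto
    moreover from this have "clique HE (C i)"
      unfolding clique_def using HE(2) by blast
    ultimately show "C i \<subseteq> {..<n} \<and> clique HE (C i) \<and> card (C i) \<le> q" by simp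
  qed
  moreover have "?H u v" if uv: "u < N" "v < N" "E' u v" for u v
  proof -
    have copy: "\<exists>i a. i < L \<and> a < m \<and> w = n + i * m + a" if "w < N" "\<not> w < n" for w
      using that copy_cases unfolding N_def by (metis not_le)
    consider "u < n" "v < n" | i a where "u < n" "a < m" "v = n + i * m + a"
      | i a where "v < n" "a < m" "u = n + i * m + a"
      | i a j b where "a < m" "u = n + i * m + a" "b < m" "v = n + j * m + b"
      using copy[OF uv(1)] copy[OF uv(2)] by blast
    then show ?thesis
    proof cases
      case 1 then show ?thesis using uv HE by (auto simp: E'_def glue_def)
    next
      case 2 then show ?thesis using uv DC by (auto simp: E'_def glue_simps)
    next
      case 3 then show ?thesis using uv DC by (auto simp: E'_def glue_simps)
    next
      case 4 then show ?thesis using uv HA by (auto simp: E'_def glue_simps)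
    qed
  qed
  ultimately have thin: "thin N (max s (q + r)) E'" using gE' by (auto simp: thin_def)
  have E'E: "E' u v = E u v" if "u < n" "v < n" for u v using that by (simp add: E'_def glue_def)
  have att: "clique_attachment {..<N} {..<n} E' (\<lambda>w. C ((w - n) div m))"
  proof
    show "{..<n} \<subseteq> {..<N}" by (auto simp: N_def)
  next
    fix w assume w: "w \<in> {..<N} - {..<n}"
    then obtain i a where ia: "i < L" "a < m" "w = n + i * m + a" "(w - n) div m = i"
      unfolding N_def by (metis DiffE copy_cases lessThan_iff not_le)
    show "C ((w - n) div m) \<subseteq> {..<n}" using ia C by simp
    show "clique E' (C ((w - n) div m))"
      using C ia E'E unfolding clique_def by (metis lessThan_iff subsetD)
    fix b assume "b \<in> {..<n}" "E' b w"
    then have "b \<in> D i a" using ia by (auto simp: E'_def glue_simps)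
    then show "b \<in> C ((w - n) div m)" using DC ia by auto
  next
    fix w w' assume "w \<in> {..<N} - {..<n}" "w' \<in> {..<N} - {..<n}" "E' w w'"
    then show "C ((w - n) div m) = C ((w' - n) div m)" by (auto simp: E'_def glue_def)
  next
    fix x y assume "x \<in> {..<N}" "y \<in> {..<N}" "E' x y"
    then show "E' y x" using gE' by (auto simp: graph_on_def)
  qed
  have "\<exists>p. attached_copy N n m p E' A d"
    if d: "(\<Union>a<m. d a) \<subseteq> {..<n}" "clique E (\<Union>a<m. d a)" "card (\<Union>a<m. d a) \<le> q" for d
  proof -
    define d' where "d' = (\<lambda>a. if a < m then d a else {})"
    have U: "(\<Union>a<m. d' a) = (\<Union>a<m. d a)" by (auto simp: d'_def)
    have "d' \<in> Ps" unfolding Ps_def mem_Collect_eq U using d by (auto simp: d'_def)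
    then obtain i where i: "i < L" "D i = d'" using xs by (auto simp: L_def D_def in_set_conv_nth)
    let ?p = "n + i * m"
    have "Suc i * m \<le> L * m" using i by (intro mult_right_mono) auto
    then have "?p + m \<le> N" by (simp add: N_def)
    moreover have "E' (?p + a) (?p + b) = A a b" if "a < m" "b < m" for a b
      using that by (simp add: E'_def glue_simps)
    moreover have "E' u (?p + a) \<longleftrightarrow> u \<in> d a" if "a < m" "u < n" for a u
      using that i by (simp add: E'_def glue_simps d'_def)
    moreover have "?p \<le> w \<and> w < ?p + m" if a: "a < m" "w < N" "n \<le> w" "E' w (?p + a)" for a w
    proof -
      obtain j b where "j < L" "b < m" "w = n + j * m + b"
        using a copy_cases unfolding N_def by metis
      moreover from this have "j = i" using a by (auto simp: E'_def glue_simps)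
      ultimately show ?thesis by simp
    qed
    ultimately have "attached_copy N n m ?p E' A d" using gE' by unfold_locales auto
    then show ?thesis by blast
  qed
  with thin E'E att show thesis by (intro that[of N E']) (auto simp: N_def)
qed

section \<open>Forcing a large clique inside a part\<close>

definition mono_clique :: "'a set \<Rightarrow> ('a \<Rightarrow> 'a \<Rightarrow> bool) \<Rightarrow> ('a \<Rightarrow> 'b) \<Rightarrow> nat \<Rightarrow> bool" where
  "mono_clique V E f j \<longleftrightarrow> (\<exists>c. \<exists>S\<subseteq>fibre V f c. clique E S \<and> card S = j)"

definition uniform_clique :: "'a set \<Rightarrow> ('a \<Rightarrow> 'a \<Rightarrow> bool) \<Rightarrow> ('a \<Rightarrow> 'b) \<Rightarrow> nat \<Rightarrow> nat \<Rightarrow> bool" where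
  "uniform_clique V E f k r \<longleftrightarrow>
     (\<exists>C\<subseteq>V. finite C \<and> clique E C \<and> card (f ` C) = r \<and> (\<forall>c\<in>f ` C. card (fibre C f c) = k))"

text \<open>
  Labels have the type of parts, since a vertex will be labelled by the part that contains it.
\<close>

definition forces_clique :: "nat \<Rightarrow> nat \<Rightarrow> (nat \<Rightarrow> nat \<Rightarrow> bool) \<Rightarrow> bool" where
  "forces_clique k n E \<longleftrightarrow>
     (\<forall>f :: nat \<Rightarrow> nat pair_pre_digraph. good_labelling {..<n} E f \<longrightarrow> mono_clique {..<n} E f k)"

text \<open>
  The intermediate goal: unless some part already contains a clique of size \<open>k + 1\<close>, there is a clique
  that meets \<open>r\<close> parts and takes \<open>k\<close> vertices from each of them.
\<close>

definition forces_uniform :: "nat \<Rightarrow> nat \<Rightarrow> nat \<Rightarrow> (nat \<Rightarrow> nat \<Rightarrow> bool) \<Rightarrow> bool" where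
  "forces_uniform k r n E \<longleftrightarrow>
     (\<forall>f :: nat \<Rightarrow> nat pair_pre_digraph. good_labelling {..<n} E f \<longrightarrow>
        mono_clique {..<n} E f (k + 1) \<or> uniform_clique {..<n} E f k r)"

lemma mono_clique_mono:
  assumes "mono_clique V E f j" "V \<subseteq> W" "\<And>u v. u \<in> V \<Longrightarrow> v \<in> V \<Longrightarrow> E u v \<Longrightarrow> E' u v"
  shows "mono_clique W E' f j"
proof -
  obtain c S where S: "S \<subseteq> fibre V f c" "clique E S" "card S = j"
    using assms(1) by (auto simp: mono_clique_def)
  have "S \<subseteq> V" using S(1) by (auto simp: fibre_def)
  then have "clique E' S" using S(2) assms(3) unfolding clique_def by (meson subsetD)
  moreover have "S \<subseteq> fibre W f c" using S(1) assms(2) by (auto simp: fibre_def)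
  ultimately show ?thesis using S(3) unfolding mono_clique_def by blast
qed

lemma card_uniform:
  assumes "finite C" "\<forall>c\<in>f ` C. card (fibre C f c) = k"
  shows "card C = k * card (f ` C)"
proof -
  have "card C = (\<Sum>c\<in>f ` C. card (fibre C f c))"
    using sum.image_gen[OF assms(1), of "\<lambda>_. 1::nat" f] by (simp add: fibre_def)
  then show ?thesis using assms(2) by simp
qed

context attached_copy
begin

lemma copy_edge_sym:
  assumes "u < N" "v < N" "E u v"
  shows "E v u"
  using graph assms unfolding graph_on_def by blast

lemma neighbour_cases:
  assumes "a < m" "w < N" "E (p + a) w"
  obtains (copy) b where "b < m" "w = p + b" "A a b" | (link) "w < n" "w \<in> d a"
proof -
  have pa: "p + a < N" using assms base_le by simp
  have wp: "E w (p + a)" using copy_edge_sym pa assms(2,3) by blast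
  show thesis
  proof (cases "w < n")
    case True
    then show thesis using link copy_link[of a w] assms(1) wp by simp
  next
    case False
    then have w: "p \<le> w" "w < p + m" using copy_neighbour[of a w] assms wp by auto
    then have "E (p + a) (p + (w - p))" using assms by simp
    then have "A a (w - p)" using copy_edge[of a "w - p"] assms(1) w by simp
    then show thesis using copy[of "w - p"] w by simp
  qed
qed

text \<open>
  A part can leave the copy only along an edge from a copied vertex to an old vertex of
  the same label.
\<close>

lemma fibre_in_copy:
  assumes conn: "connected_in (fibre {..<N} f (f (p + a))) E" and a: "a < m"
    and links: "\<And>b u. b < m \<Longrightarrow> u \<in> d b \<Longrightarrow> f (p + b) = f (p + a) \<Longrightarrow> f u \<noteq> f (p + a)"
  shows "fibre {..<N} f (f (p + a)) \<subseteq> {p..<p + m}"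
  using conn
proof (rule connected_in_subset_closed)
  show "p + a \<in> fibre {..<N} f (f (p + a))" using a base_le by (auto simp: fibre_def)
  show "p + a \<in> {p..<p + m}" using a by simp
  fix x y assume xy: "x \<in> fibre {..<N} f (f (p + a))" "y \<in> fibre {..<N} f (f (p + a))"
    "E x y" "x \<in> {p..<p + m}"
  then obtain b where b: "b < m" "x = p + b"
    by (metis atLeastLessThan_iff le_add_diff_inverse nat_add_left_cancel_less)
  have y: "y < N" "E (p + b) y" using xy b by (auto simp: fibre_def)
  show "y \<in> {p..<p + m}"
    using b(1) y
  proof (cases rule: neighbour_cases)
    case link
    then show ?thesis using links[of b y] xy b by (auto simp: fibre_def)
  qed auto
qed

text \<open>
  If the copy shares no label with the old vertices attached to it, then every part that meets the copy
  lies inside it, and the quotient of the copy is an induced subgraph of the whole quotient.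
\<close>

lemma good_labelling_copy:
  assumes good: "good_labelling {..<N} E f"
    and links: "\<And>a b u. a < m \<Longrightarrow> b < m \<Longrightarrow> u \<in> d b \<Longrightarrow> f u \<noteq> f (p + a)"
  shows "good_labelling {..<m} A (\<lambda>a. f (p + a))"
proof -
  let ?g = "\<lambda>a. f (p + a)"
  have conn: "connected_in (fibre {..<N} f c) E" for c
    using good by (simp add: good_labelling_def)
  have fib: "fibre {..<N} f c = (+) p ` fibre {..<m} ?g c" if c: "c \<in> ?g ` {..<m}" for c
  proof
    obtain a where a: "a < m" "c = ?g a" using c by auto
    have sub: "fibre {..<N} f c \<subseteq> {p..<p + m}"
      using fibre_in_copy[of f a] conn a links by auto
    show "fibre {..<N} f c \<subseteq> (+) p ` fibre {..<m} ?g c"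
    proof
      fix x assume x: "x \<in> fibre {..<N} f c"
      then have "p \<le> x" "x < p + m" using sub by auto
      then have "x = p + (x - p)" "x - p < m" by simp_all
      moreover from this have "x - p \<in> fibre {..<m} ?g c" using x by (auto simp: fibre_def)
      ultimately show "x \<in> (+) p ` fibre {..<m} ?g c" by blast
    qed
  qed (use base_le in \<open>auto simp: fibre_def\<close>)
  have "connected_in (fibre {..<m} ?g c) A" for c
    unfolding connected_in_def
  proof (intro ballI)
    let ?S = "fibre {..<m} ?g c"
    fix a b assume ab: "a \<in> ?S" "b \<in> ?S"
    then have F: "fibre {..<N} f c = (+) p ` ?S" using fib[of c] by (auto simp: fibre_def)
    have "joined_in ?S A a (p + b - p)"
      using conn[of c]
    proof (rule connected_in_induct[where P = "\<lambda>z. joined_in ?S A a (z - p)" and z = "p + b"])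
      show "p + a \<in> fibre {..<N} f c" "p + b \<in> fibre {..<N} f c" using ab unfolding F by auto
      show "joined_in ?S A a (p + a - p)" by (simp add: joined_in_refl)
      fix x y assume xy: "x \<in> fibre {..<N} f c" "y \<in> fibre {..<N} f c" "E x y"
        "joined_in ?S A a (x - p)"
      then obtain i j where ij: "x = p + i" "y = p + j" "i \<in> ?S" "j \<in> ?S" unfolding F by auto
      then have "A i j" using copy_edge[of i j] xy by (auto simp: fibre_def)
      then show "joined_in ?S A a (y - p)" using xy(4) ij by (auto intro: joined_in_step)
    qed
    then show "joined_in ?S A a b" by simp
  qed
  moreover have touch: "touches {..<N} E f c c' \<longleftrightarrow> touches {..<m} A ?g c c'"
    if "c \<in> ?g ` {..<m}" "c' \<in> ?g ` {..<m}" for c c'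
  proof -
    have "i < m" if "i \<in> fibre {..<m} ?g x" for i x using that by (simp add: fibre_def)
    then show ?thesis
      unfolding touches_def fib[OF that(1)] fib[OF that(2)] using copy_edge by simp
  qed
  have pent: "pentagon (touches {..<N} E f) x1 x2 x3 x4 x5"
    if "pentagon (touches {..<m} A ?g) x1 x2 x3 x4 x5" for x1 x2 x3 x4 x5
    using that
  proof (rule pentagon_transfer[where L = "?g ` {..<m}"])
    show "x \<in> ?g ` {..<m} \<and> y \<in> ?g ` {..<m}" if "touches {..<m} A ?g x y" for x y
      using touches_labels[OF that] .
    show "touches {..<N} E f x y \<longleftrightarrow> touches {..<m} A ?g x y"
      if "x \<in> ?g ` {..<m}" "y \<in> ?g ` {..<m}" for x y
      using touch that .
  qed
  ultimately show ?thesis using good pent unfolding good_labelling_def by blast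
qed

end

text \<open>
  With \<open>k = 0\<close> a new copy need not contribute a new label, so \<open>k\<close> must be positive.
\<close>

lemma forces_uniform_Suc:
  assumes "1 \<le> k"
    and B: "thin n s E" "forces_uniform k r n E"
    and A: "thin m t A" "forces_clique k m A"
  shows "\<exists>N E'. thin N (max s (k * r + t)) E' \<and> forces_uniform k (r + 1) N E'"
proof -
  obtain N E' own where N: "thin N (max s (k * r + t)) E'" "n \<le> N"
    and E': "\<And>u v. u < n \<Longrightarrow> v < n \<Longrightarrow> E' u v = E u v"
    and att: "clique_attachment {..<N} {..<n} E' own"
    and copies: "\<And>d. (\<Union>a<m. d a) \<subseteq> {..<n} \<Longrightarrow> clique E (\<Union>a<m. d a) \<Longrightarrow>
       card (\<Union>a<m. d a) \<le> k * r \<Longrightarrow> \<exists>p. attached_copy N n m p E' A d"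
    using attach_copies[OF B(1) A(1), of "k * r"] by blast
  have "uniform_clique {..<N} E' f k (r + 1) \<or> mono_clique {..<N} E' f (k + 1)"
    if good: "good_labelling {..<N} E' f" for f :: "nat \<Rightarrow> nat pair_pre_digraph"
  proof (rule disjCI)
    assume no_mono: "\<not> mono_clique {..<N} E' f (k + 1)"
    have "good_labelling {..<n} E' f" using clique_attachment.good_labelling_base[OF att good] .
    then have "good_labelling {..<n} E f" using good_labelling_cong[of "{..<n}" E' E f] E' by auto
    moreover have "\<not> mono_clique {..<n} E f (k + 1)"
      using no_mono mono_clique_mono[of "{..<n}" E f "k + 1" "{..<N}" E'] E' \<open>n \<le> N\<close> by auto
    ultimately have "uniform_clique {..<n} E f k r"
      using B(2) unfolding forces_uniform_def by blast
    then obtain C where C: "C \<subseteq> {..<n}" "finite C" "clique E C" "card (f ` C) = r"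
      "\<forall>c\<in>f ` C. card (fibre C f c) = k"
      unfolding uniform_clique_def by blast
    have C': "clique E' C" using C(1,3) E' unfolding clique_def by (meson lessThan_iff subsetD)
    have cardC: "card C = k * r" using card_uniform[OF C(2,5)] C(4) by simp
    have "(\<Union>a<m. C) \<subseteq> C" by auto
    then obtain p where "attached_copy N n m p E' A (\<lambda>_. C)"
      using copies[of "\<lambda>_. C"] C clique_subset cardC card_mono by (metis subset_trans)
    then interpret attached_copy N n m p E' A "\<lambda>_. C" .
    have link: "E' u (p + a)" "E' (p + a) u" if "u \<in> C" "a < m" for u a
    proof -
      have "u < n" using that C by auto
      then show "E' u (p + a)" using copy_link that by simp
      then show "E' (p + a) u" using copy_edge_sym[of u "p + a"] \<open>u < n\<close> that base_le by simp
    qed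
    \<comment> \<open>A shared label would extend the \<open>k\<close> vertices of that label in \<open>C\<close> to a clique of size \<open>k + 1\<close>.\<close>
    have new: "f u \<noteq> f (p + a)" if u: "u \<in> C" "a < m" for u a
    proof
      assume eq: "f u = f (p + a)"
      let ?S = "insert (p + a) (fibre C f (f u))"
      have "clique E' ?S"
        using C' link u unfolding clique_def fibre_def by auto
      moreover have "?S \<subseteq> fibre {..<N} f (f u)"
        using C(1) base_le u eq by (auto simp: fibre_def)
      moreover have "p + a \<notin> C" using C(1) base_le by auto
      then have "card ?S = k + 1" using C(2,5) u by (simp add: fibre_def)
      ultimately show False using no_mono unfolding mono_clique_def by blast
    qed
    then have "good_labelling {..<m} A (\<lambda>a. f (p + a))"
      by (intro good_labelling_copy[OF good]) auto
    then obtain c S where S: "S \<subseteq> fibre {..<m} (\<lambda>a. f (p + a)) c" "clique A S" "card S = k"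
      using A(2) unfolding forces_clique_def mono_clique_def by blast
    let ?T = "(+) p ` S"
    have Sm: "a < m" "f (p + a) = c" if "a \<in> S" for a using S(1) that by (auto simp: fibre_def)
    have "finite S" using S(3) \<open>1 \<le> k\<close> by (auto intro: card_ge_0_finite)
    have "S \<noteq> {}" using S(3) \<open>1 \<le> k\<close> by auto
    then obtain a where a: "a \<in> S" by blast
    have c: "c \<notin> f ` C"
    proof
      assume "c \<in> f ` C"
      then obtain u where "u \<in> C" "f u = c" by auto
      then show False using new[of u a] Sm[OF a] by simp
    qed
    have "clique E' (C \<union> ?T)"
      unfolding clique_def
    proof (intro ballI impI)
      fix x y assume xy: "x \<in> C \<union> ?T" "y \<in> C \<union> ?T" "x \<noteq> y"
      have "x \<in> C \<or> (\<exists>a\<in>S. x = p + a)" "y \<in> C \<or> (\<exists>b\<in>S. y = p + b)" using xy(1,2) by auto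
      then consider "x \<in> C" "y \<in> C" | a where "x \<in> C" "a \<in> S" "y = p + a"
        | a where "a \<in> S" "x = p + a" "y \<in> C" | a b where "a \<in> S" "x = p + a" "b \<in> S" "y = p + b"
        by metis
      then show "E' x y"
      proof cases
        case 1 then show ?thesis using C' xy by (auto simp: clique_def)
      next
        case 4 then show ?thesis using S(2) Sm xy copy_edge by (auto simp: clique_def)
      qed (use link Sm in auto)
    qed
    moreover have "f ` (C \<union> ?T) = insert c (f ` C)"
      using Sm \<open>a \<in> S\<close> by (force simp: image_Un image_image)
    moreover from this have "card (f ` (C \<union> ?T)) = r + 1" using c C(2,4) by simp
    moreover have "card (fibre (C \<union> ?T) f c') = k" if "c' \<in> insert c (f ` C)" for c'
    proof (cases "c' = c")
      case True
      then have "fibre (C \<union> ?T) f c' = ?T" using Sm c by (auto simp: fibre_def)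
      then show ?thesis using S(3) by (simp add: card_image)
    next
      case False
      then have "fibre (C \<union> ?T) f c' = fibre C f c'" using Sm by (auto simp: fibre_def)
      then show ?thesis using that False bspec[OF C(5), of c'] by simp
    qed
    moreover have "C \<union> ?T \<subseteq> {..<N}" using C(1) Sm base_le by fastforce
    ultimately show "uniform_clique {..<N} E' f k (r + 1)"
      unfolding uniform_clique_def using C(2) \<open>finite S\<close> by (intro exI[of _ "C \<union> ?T"]) simp
  qed
  then show ?thesis using N(1) unfolding forces_uniform_def by blast
qed

text \<open>
  Two cliques \<open>{0..k}\<close> and \<open>{k..2k}\<close> that share the vertex \<open>k\<close>, the vertex \<open>y\<close> of the introduction.
\<close>

definition bowtie :: "nat \<Rightarrow> nat \<Rightarrow> nat \<Rightarrow> bool" where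
  "bowtie k a b \<longleftrightarrow> a \<noteq> b \<and> (a \<le> k \<and> b \<le> k \<or> k \<le> a \<and> k \<le> b)"

lemma thin_bowtie: "thin (2 * k + 1) (2 * k + 1) (bowtie k)"
proof -
  have "earlier (\<noteq>) v = {..<v}" for v by (auto simp: earlier_def)
  then have "elimination (2 * k + 1) (2 * k + 1) (\<noteq>)"
    by (auto simp: elimination_def graph_on_def clique_def)
  moreover have "graph_on (2 * k + 1) (bowtie k)" by (auto simp: graph_on_def bowtie_def)
  moreover have "\<forall>u v. bowtie k u v \<longrightarrow> u \<noteq> v" by (simp add: bowtie_def)
  ultimately show ?thesis unfolding thin_def by (intro conjI exI[of _ "(\<noteq>)"]) auto
qed

text \<open>
  Write \<open>?x i\<close> for the label of the copied vertex \<open>i\<close> and \<open>col i\<close> for the label of the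
  class of \<open>C\<close> joined to it.  The induced five-cycle is \<open>col i\<close>, \<open>?x i\<close>, \<open>?x k\<close>, \<open>?x j\<close>, \<open>col j\<close> with
  \<open>i < k < j\<close>; the required non-adjacencies come from two facts.  A label of the copy touches \<open>col j\<close>
  only if it is \<open>?x j\<close> (\<open>touch_col\<close>), and a label different from that of the shared vertex stays within
  one of the two cliques (\<open>wing\<close>).
\<close>

lemma forces_clique_Suc:
  assumes B: "thin n s E" "forces_uniform k (2 * k) n E"
  shows "\<exists>N E'. thin N (max s (k * (2 * k) + (2 * k + 1))) E' \<and> forces_clique (k + 1) N E'"
proof -
  let ?m = "2 * k + 1"
  obtain N E' own where N: "thin N (max s (k * (2 * k) + ?m)) E'" "n \<le> N"
    and E': "\<And>u v. u < n \<Longrightarrow> v < n \<Longrightarrow> E' u v = E u v"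
    and att: "clique_attachment {..<N} {..<n} E' own"
    and copies: "\<And>d. (\<Union>a<?m. d a) \<subseteq> {..<n} \<Longrightarrow> clique E (\<Union>a<?m. d a) \<Longrightarrow>
       card (\<Union>a<?m. d a) \<le> k * (2 * k) \<Longrightarrow> \<exists>p. attached_copy N n ?m p E' (bowtie k) d"
    using attach_copies[OF B(1) thin_bowtie, of "k * (2 * k)" k] by blast
  have "mono_clique {..<N} E' f (k + 1)"
    if good: "good_labelling {..<N} E' f" for f :: "nat \<Rightarrow> nat pair_pre_digraph"
  proof (rule ccontr)
    assume no_mono: "\<not> mono_clique {..<N} E' f (k + 1)"
    have conn: "connected_in (fibre {..<N} f c) E'" for c
      using good by (simp add: good_labelling_def)
    have "good_labelling {..<n} E' f" using clique_attachment.good_labelling_base[OF att good] .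
    then have "good_labelling {..<n} E f" using good_labelling_cong[of "{..<n}" E' E f] E' by auto
    moreover have "\<not> mono_clique {..<n} E f (k + 1)"
      using no_mono mono_clique_mono[of "{..<n}" E f "k + 1" "{..<N}" E'] E' \<open>n \<le> N\<close> by auto
    ultimately have "uniform_clique {..<n} E f k (2 * k)"
      using B(2) unfolding forces_uniform_def by blast
    then obtain C where C: "C \<subseteq> {..<n}" "finite C" "clique E C" "card (f ` C) = 2 * k"
      "\<forall>c\<in>f ` C. card (fibre C f c) = k"
      unfolding uniform_clique_def by blast
    have C': "clique E' C" using C(1,3) E' unfolding clique_def by (meson lessThan_iff subsetD)
    have cardC: "card C = k * (2 * k)" using card_uniform[OF C(2,5)] C(4) by simp
    \<comment> \<open>The shared vertex \<open>k\<close> gets no neighbour in \<open>C\<close>; the other \<open>2 * k\<close> vertices get one label class each.\<close>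
    let ?I = "{..<?m} - {k}"
    have "card ?I = card (f ` C)" using C(4) by simp
    then obtain col where col: "bij_betw col ?I (f ` C)"
      using C(2) by (metis finite_Diff finite_imageI finite_lessThan finite_same_card_bij)
    have col_in: "col i \<in> f ` C" if "i \<in> ?I" for i using col that by (auto simp: bij_betw_def)
    have col_inj: "i = j" if "col i = col j" "i \<in> ?I" "j \<in> ?I" for i j
      using col that by (auto simp: bij_betw_def inj_on_def)
    define d where "d i = (if i = k then {} else fibre C f (col i))" for i
    have dC: "(\<Union>a<?m. d a) \<subseteq> C" by (auto simp: d_def fibre_def)
    have d_col: "u \<in> C" "f u = col i" "i \<in> ?I" if "u \<in> d i" "i < ?m" for u i
      using that by (auto simp: d_def fibre_def split: if_splits)
    obtain p where "attached_copy N n ?m p E' (bowtie k) d"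
      using copies[of d] dC C clique_subset cardC card_mono by (metis subset_trans)
    then interpret attached_copy N n ?m p E' "bowtie k" d .
    let ?x = "\<lambda>i. f (p + i)"
    have lt_N: "p + i < N" if "i < ?m" for i using that base_le by simp
    have x_fibre: "p + i \<in> fibre {..<N} f (?x i)" if "i < ?m" for i
      using that lt_N by (simp add: fibre_def)
    have C_fibre: "fibre C f c \<subseteq> fibre {..<N} f c" for c
      using C(1) \<open>n \<le> N\<close> by (auto simp: fibre_def)
    have link: "E' u (p + i)" "E' (p + i) u" if "u \<in> fibre C f (col i)" "i \<in> ?I" for u i
    proof -
      have "u < n" using that C(1) by (auto simp: fibre_def)
      then show "E' u (p + i)" using copy_link[of i u] that by (simp add: d_def)
      then show "E' (p + i) u" using copy_edge_sym[of u "p + i"] \<open>u < n\<close> \<open>n \<le> N\<close> lt_N that by simp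
    qed
    \<comment> \<open>Otherwise the vertex would complete its class to a monochromatic clique of size \<open>k + 1\<close>.\<close>
    have own_col: "?x i \<noteq> col i" if i: "i \<in> ?I" for i
    proof
      assume eq: "?x i = col i"
      let ?S = "insert (p + i) (fibre C f (col i))"
      have "clique E' (fibre C f (col i))" using C' by (rule clique_subset) (auto simp: fibre_def)
      then have "clique E' ?S" using link i unfolding clique_def by blast
      moreover have "?S \<subseteq> fibre {..<N} f (col i)" using C_fibre x_fibre[of i] i eq by auto
      moreover have "card ?S = k + 1"
      proof -
        have "p + i \<notin> fibre C f (col i)" using C(1) base_le by (auto simp: fibre_def)
        moreover have "finite (fibre C f (col i))" using C(2) by (simp add: fibre_def)
        ultimately show ?thesis using bspec[OF C(5) col_in[OF i]] by simp
      qed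
      ultimately show False using no_mono unfolding mono_clique_def by blast
    qed
    \<comment> \<open>Parts that meet the copy cannot leave it: the exit would be a vertex with the label of its own class.\<close>
    have in_copy: "fibre {..<N} f (?x i) \<subseteq> {p..<p + ?m}" if "i < ?m" for i
      using conn that
    proof (rule fibre_in_copy)
      fix b u assume "b < ?m" "u \<in> d b" "?x b = ?x i"
      then show "f u \<noteq> ?x i" using d_col own_col by metis
    qed
    have not_col: "?x i \<notin> f ` C" if "i < ?m" for i
    proof
      assume "?x i \<in> f ` C"
      then obtain u where "u \<in> C" "f u = ?x i" by auto
      then have "u \<in> fibre {..<N} f (?x i)" "u < p" using C(1) \<open>n \<le> N\<close> base_le by (auto simp: fibre_def)
      then show False using in_copy[OF that] by auto
    qed
    have label_cases: "\<exists>j. j < ?m \<and> w = p + j \<and> ?x j = ?x i"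
      if "w \<in> fibre {..<N} f (?x i)" "i < ?m" for w i
    proof -
      have "p \<le> w" "w < p + ?m" using in_copy that by fastforce+
      then show ?thesis using that(1) by (intro exI[of _ "w - p"]) (auto simp: fibre_def)
    qed
    have touch_col: "?x i = ?x j"
      if t: "touches {..<N} E' f (?x i) (col j) \<or> touches {..<N} E' f (col j) (?x i)"
        and i: "i < ?m" and j: "j \<in> ?I" for i j
    proof -
      obtain v w where vw: "v \<in> fibre {..<N} f (?x i)" "w \<in> fibre {..<N} f (col j)" "E' v w"
        using t copy_edge_sym by (auto simp: touches_def fibre_def)
      obtain l where l: "l < ?m" "v = p + l" "?x l = ?x i" using label_cases vw i by blast
      have "w < N" "E' (p + l) w" using vw l by (auto simp: fibre_def)
      with l(1) show ?thesis
      proof (cases rule: neighbour_cases)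
        case (copy b)
        then show ?thesis using vw(2) not_col[of b] col_in[OF j] by (auto simp: fibre_def)
      next
        case link
        then have "col l = col j" "l \<in> ?I" using d_col[of w l] l vw by (auto simp: fibre_def)
        then show ?thesis using col_inj j l by metis
      qed
    qed
    \<comment> \<open>Otherwise the copy of \<open>J\<close> is a monochromatic clique; this is needed for both cliques of the gadget.\<close>
    have split: "\<exists>i\<in>J. ?x i \<noteq> ?x k"
      if J: "card J = k + 1" "J \<subseteq> {..<?m}" "clique (bowtie k) J" for J
    proof (rule ccontr)
      assume same: "\<not> (\<exists>i\<in>J. ?x i \<noteq> ?x k)"
      have "E' (p + a) (p + b)" if "a \<in> J" "b \<in> J" "a \<noteq> b" for a b
        using J(2,3) copy_edge[of a b] that unfolding clique_def by blast
      then have "clique E' ((+) p ` J)" by (auto simp: clique_def)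
      moreover have "(+) p ` J \<subseteq> fibre {..<N} f (?x k)"
        using same J lt_N by (auto simp: fibre_def)
      ultimately show False
        using no_mono J(1) unfolding mono_clique_def by (metis card_image inj_on_add)
    qed
    have "\<exists>i\<in>{..k}. ?x i \<noteq> ?x k"
      by (rule split) (auto simp: clique_def bowtie_def)
    then obtain i where i: "i < k" "?x i \<noteq> ?x k" by (metis atMost_iff order_le_less)
    have "\<exists>j\<in>{k..<?m}. ?x j \<noteq> ?x k"
      by (rule split) (auto simp: clique_def bowtie_def)
    then obtain j where j: "k < j" "j < ?m" "?x j \<noteq> ?x k"
      by (metis atLeastLessThan_iff order_le_less)
    have ij: "i < ?m" "i \<in> ?I" "j \<in> ?I" using i j by auto
    have touch_x: "touches {..<N} E' f (?x a) (?x b)" if "a < ?m" "b < ?m" "bowtie k a b" for a b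
      unfolding touches_def using x_fibre copy_edge that by blast
    \<comment> \<open>The vertex shared by the two cliques of the copy separates them.\<close>
    have wing: "\<exists>b\<in>J. w = p + b"
      if w: "w \<in> fibre {..<N} f (?x a)" and a: "a \<in> J" "?x a \<noteq> ?x k" and J: "J \<subseteq> {..<?m}"
        and sep: "\<And>b c. b \<in> J \<Longrightarrow> c < ?m \<Longrightarrow> bowtie k b c \<Longrightarrow> c \<in> J \<or> c = k" for J a w
    proof -
      have "fibre {..<N} f (?x a) \<subseteq> (+) p ` J"
        using conn
      proof (rule connected_in_subset_closed)
        show "p + a \<in> fibre {..<N} f (?x a)" using x_fibre a(1) J by auto
        show "p + a \<in> (+) p ` J" using a by simp
        fix x y assume xy: "x \<in> fibre {..<N} f (?x a)" "y \<in> fibre {..<N} f (?x a)"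
          "E' x y" "x \<in> (+) p ` J"
        obtain c where c: "c < ?m" "y = p + c" "?x c = ?x a"
          using label_cases[OF xy(2)] a(1) J by auto
        obtain b where b: "b \<in> J" "x = p + b" using xy(4) by auto
        have "bowtie k b c" using copy_edge[of b c] b c xy(3) J by auto
        then show "y \<in> (+) p ` J" using sep[OF b(1) c(1)] c a(2) by auto
      qed
      then show ?thesis using w by auto
    qed
    have "\<exists>b\<in>{..<k}. w = p + b" if "w \<in> fibre {..<N} f (?x i)" for w
      using that _ i(2) by (rule wing) (use i(1) in \<open>auto simp: bowtie_def\<close>)
    then have wing1: "\<exists>b<k. w = p + b" if "w \<in> fibre {..<N} f (?x i)" for w
      using that by (metis lessThan_iff)
    have "\<exists>b\<in>{k<..<?m}. w = p + b" if "w \<in> fibre {..<N} f (?x j)" for w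
      using that _ j(3) by (rule wing) (use j(1,2) in \<open>auto simp: bowtie_def\<close>)
    then have wing2: "\<exists>b. k < b \<and> b < ?m \<and> w = p + b" if "w \<in> fibre {..<N} f (?x j)" for w
      using that by (metis greaterThanLessThan_iff)
    have x_neq: "?x i \<noteq> ?x j"
      using wing2[of "p + i"] x_fibre[of i] i by auto
    have far: "\<not> touches {..<N} E' f (?x i) (?x j)"
    proof
      assume "touches {..<N} E' f (?x i) (?x j)"
      then obtain v w where vw: "v \<in> fibre {..<N} f (?x i)" "w \<in> fibre {..<N} f (?x j)" "E' v w"
        by (auto simp: touches_def)
      then obtain a b where "a < k" "k < b" "b < ?m" "E' (p + a) (p + b)"
        using wing1 wing2 by metis
      then show False using copy_edge[of a b] by (auto simp: bowtie_def)
    qed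
    have col_touch: "touches {..<N} E' f (col a) (?x a)" "touches {..<N} E' f (?x a) (col a)"
      if a: "a \<in> ?I" for a
    proof -
      obtain w where "w \<in> fibre C f (col a)" using col_in[OF a] by (auto simp: fibre_def)
      then show "touches {..<N} E' f (col a) (?x a)" "touches {..<N} E' f (?x a) (col a)"
        using C_fibre link[of w a] x_fibre[of a] a unfolding touches_def by auto
    qed
    have col_neq: "col i \<noteq> col j" using col_inj[of i j] ij i j by auto
    have "touches {..<N} E' f (col j) (col i)"
    proof -
      obtain v w where vw: "v \<in> fibre C f (col j)" "w \<in> fibre C f (col i)"
        using col_in[OF ij(2)] col_in[OF ij(3)] by (auto simp: fibre_def)
      then have "v \<in> C" "w \<in> C" "v \<noteq> w" using col_neq by (auto simp: fibre_def)
      then have "E' v w" using C' by (simp add: clique_def)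
      then show ?thesis using vw C_fibre unfolding touches_def by blast
    qed
    moreover have "distinct [col i, ?x i, ?x k, ?x j, col j]"
      using col_neq x_neq i(2) j(3) not_col[of i] not_col[of j] not_col[of k]
        col_in[OF ij(2)] col_in[OF ij(3)] ij(1) j(2) by (auto dest: sym)
    moreover have "touches {..<N} E' f (?x i) (?x k)" "touches {..<N} E' f (?x k) (?x j)"
      using touch_x[of i k] touch_x[of k j] i j by (auto simp: bowtie_def)
    moreover have "\<not> touches {..<N} E' f (col i) (?x k)" "\<not> touches {..<N} E' f (?x k) (col j)"
      using touch_col[of k i] touch_col[of k j] ij i j by auto
    moreover have "\<not> touches {..<N} E' f (col i) (?x j)" "\<not> touches {..<N} E' f (?x i) (col j)"
      using touch_col[of j i] touch_col[of i j] ij j x_neq by auto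
    ultimately have "pentagon (touches {..<N} E' f) (col i) (?x i) (?x k) (?x j) (col j)"
      using col_touch ij far unfolding pentagon_def by blast
    then show False using good unfolding good_labelling_def by blast
  qed
  then show ?thesis using N(1) unfolding forces_clique_def by blast
qed

lemma thin_mono: "thin n s E \<Longrightarrow> s \<le> s' \<Longrightarrow> thin n s' E"
  unfolding thin_def elimination_def by (meson order_less_le_trans)

lemma thin_empty: "thin 0 s E"
  by (auto simp: thin_def elimination_def graph_on_def)

lemma forces_uniform_0: "forces_uniform k 0 0 E"
  by (auto simp: forces_uniform_def uniform_clique_def clique_def)

lemma forces_uniform_exists:
  assumes "1 \<le> k" "thin m t A" "forces_clique k m A"
  shows "\<exists>n E. thin n (k * r + t) E \<and> forces_uniform k r n E"
proof (induction r)
  case 0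
  show ?case using forces_uniform_0 thin_empty by blast
next
  case (Suc r)
  then obtain n E where "thin n (k * r + t) E" "forces_uniform k r n E" by blast
  then obtain N E' where "thin N (max (k * r + t) (k * r + t)) E'" "forces_uniform k (r + 1) N E'"
    using forces_uniform_Suc[OF assms(1) _ _ assms(2,3)] by blast
  moreover from this have "thin N (k * Suc r + t) E'" by (auto intro: thin_mono)
  ultimately show ?case by (metis Suc_eq_plus1)
qed

text \<open>
  Passing from \<open>k\<close> to \<open>k + 1\<close> replaces \<open>s\<close> by at most the maximum of \<open>2 k\<^sup>2 + s\<close> (growing a clique
  with \<open>2 k\<close> labels) and \<open>2 k\<^sup>2 + 2 k + 1\<close> (the last gadget over such a clique).  Both
  stay below \<open>(2 (k + 1)\<^sup>3 + 16) / 3\<close>; this choice of bound is what makes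
  \<open>s \<le> t\<close> follow from \<open>k\<^sup>3 \<le> 3 t / 2 - 8\<close>.
\<close>

lemma clique_forcing_graph:
  "\<exists>n s E. thin n s E \<and> forces_clique k n E \<and> 3 * s \<le> 2 * k ^ 3 + 16"
proof (induction k)
  case 0
  have "forces_clique 0 0 (\<lambda>_ _. False)"
    unfolding forces_clique_def mono_clique_def clique_def by (auto intro!: exI[of _ "{}"])
  then show ?case using thin_empty[of 0] by fastforce
next
  case (Suc k)
  then obtain m t A where A: "thin m t A" "forces_clique k m A" "3 * t \<le> 2 * k ^ 3 + 16"
    by blast
  have "\<exists>n E. thin n (k * (2 * k) + t) E \<and> forces_uniform k (2 * k) n E"
  proof (cases "k = 0")
    case True
    then show ?thesis using forces_uniform_0[of 0] thin_empty by fastforce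
  next
    case False
    then show ?thesis using forces_uniform_exists A by simp
  qed
  then obtain n E where "thin n (k * (2 * k) + t) E" "forces_uniform k (2 * k) n E" by blast
  then obtain N E' where N: "thin N (max (k * (2 * k) + t) (k * (2 * k) + (2 * k + 1))) E'"
      "forces_clique (k + 1) N E'"
    using forces_clique_Suc by blast
  moreover have "3 * max (k * (2 * k) + t) (k * (2 * k) + (2 * k + 1)) \<le> 2 * Suc k ^ 3 + 16"
  proof -
    have eqs: "Suc k ^ 3 = k ^ 3 + 3 * k\<^sup>2 + 3 * k + 1" "k * (2 * k) = 2 * k\<^sup>2"
      by (simp_all add: power3_eq_cube power2_eq_square algebra_simps)
    have "3 * (k * (2 * k) + t) \<le> 2 * Suc k ^ 3 + 16"
      unfolding eqs using A(3) by simp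
    moreover have "3 * (k * (2 * k) + (2 * k + 1)) \<le> 2 * Suc k ^ 3 + 16"
      unfolding eqs by simp
    ultimately show ?thesis by (metis max_def)
  qed
  ultimately show ?case by auto
qed

section \<open>Clique minors\<close>

text \<open>
  Delete the last vertex \<open>n\<close>, whose neighbourhood is a clique.  If \<open>n\<close> alone is a branch set, all other
  branch sets meet its fewer than \<open>s\<close> neighbours.  Otherwise the branch sets
  survive the deletion, because \<open>n\<close> is attached to the rest along a clique.
\<close>

lemma no_large_clique_minor:
  assumes "elimination n s H"
    and "\<And>x. x < j \<Longrightarrow> M x \<noteq> {} \<and> M x \<subseteq> {..<n} \<and> connected_in (M x) H"
    and "\<And>x y. x < j \<Longrightarrow> y < j \<Longrightarrow> x \<noteq> y \<Longrightarrow> M x \<inter> M y = {} \<and> (\<exists>u\<in>M x. \<exists>v\<in>M y. H u v)"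
  shows "j \<le> s"
  using assms
proof (induction n arbitrary: M)
  case 0
  then have "\<not> 0 < j" by fastforce
  then show ?case by simp
next
  case (Suc n)
  let ?C = "earlier H n"
  have symH: "H y x" if "x < Suc n" "y < Suc n" "H x y" for x y
    using Suc.prems(1) that unfolding elimination_def graph_on_def by blast
  have C: "clique H ?C" "card ?C < s" using Suc.prems(1) by (auto simp: elimination_def)
  show ?case
  proof (cases "\<exists>x<j. M x = {n}")
    case True
    then obtain x where x: "x < j" "M x = {n}" by blast
    have "\<exists>w. w \<in> M y \<inter> ?C" if y: "y \<in> {..<j} - {x}" for y
    proof -
      obtain w where w: "w \<in> M y" "H n w" "n \<notin> M y" using Suc.prems(3)[of x y] x y by auto
      moreover have "w < Suc n" using Suc.prems(2)[of y] w(1) y by auto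
      moreover from this have "w < n" using w by (metis less_antisym)
      ultimately show ?thesis using symH[of n w] by (auto simp: earlier_def)
    qed
    then obtain g where g: "\<And>y. y \<in> {..<j} - {x} \<Longrightarrow> g y \<in> M y \<inter> ?C" by metis
    have "inj_on g ({..<j} - {x})"
    proof (rule inj_onI)
      fix y z assume "y \<in> {..<j} - {x}" "z \<in> {..<j} - {x}" "g y = g z"
      then show "y = z" using g[of y] g[of z] Suc.prems(3)[of y z] by auto
    qed
    moreover have "g ` ({..<j} - {x}) \<subseteq> ?C" using g by blast
    ultimately have "card ({..<j} - {x}) \<le> card ?C" by (auto intro: card_inj_on_le)
    then show ?thesis using x C by auto
  next
    case False
    interpret clique_attachment "{..<Suc n}" "{..<n}" H "\<lambda>_. ?C"
    proof
      fix b w assume "b \<in> {..<n}" "w \<in> {..<Suc n} - {..<n}" "H b w"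
      moreover from this have "w = n" by auto
      ultimately show "b \<in> ?C" by (auto simp: earlier_def)
    qed (use C symH in \<open>auto simp: earlier_def\<close>)
    show ?thesis
    proof (rule Suc.IH)
      show "elimination n s H" using Suc.prems(1) by (auto simp: elimination_def graph_on_def)
    next
      fix x assume x: "x < j"
      then have Mx: "M x \<noteq> {}" "M x \<subseteq> {..<Suc n}" "connected_in (M x) H" "M x \<noteq> {n}"
        using Suc.prems(2) False by auto
      then have "M x \<inter> {..<n} \<noteq> {}" unfolding lessThan_Suc by blast
      then show "M x \<inter> {..<n} \<noteq> {} \<and> M x \<inter> {..<n} \<subseteq> {..<n} \<and> connected_in (M x \<inter> {..<n}) H"
        using connected_in_base Mx by simp
    next
      fix x y assume xy: "x < j" "y < j" "x \<noteq> y"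
      have M: "connected_in (M z) H" "M z \<subseteq> {..<Suc n}" "M z \<inter> {..<n} \<noteq> {}" if "z < j" for z
        using Suc.prems(2)[OF that] False that unfolding lessThan_Suc by blast+
      show "M x \<inter> {..<n} \<inter> (M y \<inter> {..<n}) = {} \<and> (\<exists>u\<in>M x \<inter> {..<n}. \<exists>v\<in>M y \<inter> {..<n}. H u v)"
        using Suc.prems(3)[OF xy] adjacent_in_base[OF M[OF xy(1)] M[OF xy(2)]] by blast
    qed
  qed
qed

definition graph_of :: "nat \<Rightarrow> (nat \<Rightarrow> nat \<Rightarrow> bool) \<Rightarrow> nat pair_pre_digraph" where
  "graph_of n E = \<lparr> pverts = {..<n}, parcs = {(u, v). u < n \<and> v < n \<and> E u v} \<rparr>"

lemma graph_of_simps [simp]: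
  "pverts (graph_of n E) = {..<n}"
  "(u, v) \<in> parcs (graph_of n E) \<longleftrightarrow> u < n \<and> v < n \<and> E u v"
  by (simp_all add: graph_of_def)

lemma pair_graph_graph_of:
  assumes "graph_on n E"
  shows "pair_graph (graph_of n E)"
proof
  show "finite (parcs (graph_of n E))"
    by (rule finite_subset[of _ "{..<n} \<times> {..<n}"]) auto
  show "symmetric (with_proj (graph_of n E))"
    using assms by (auto simp: symmetric_def graph_on_def intro!: symI)
qed (use assms in \<open>auto simp: graph_on_def\<close>)

lemma rtrancl_on_iff_joined_in:
  "(u, v) \<in> rtrancl_on S R \<longleftrightarrow> u \<in> S \<and> joined_in S (\<lambda>x y. (x, y) \<in> R) u v"
proof
  assume "(u, v) \<in> rtrancl_on S R"
  then show "u \<in> S \<and> joined_in S (\<lambda>x y. (x, y) \<in> R) u v"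
    by (induction rule: rtrancl_on.induct)
      (auto intro: joined_in_refl joined_in_step dest: in_rtrancl_on_in_F)
next
  assume *: "u \<in> S \<and> joined_in S (\<lambda>x y. (x, y) \<in> R) u v"
  then have "joined_in S (\<lambda>x y. (x, y) \<in> R) u v" by simp
  then show "(u, v) \<in> rtrancl_on S R" unfolding joined_in_def
    by (induction rule: rtranclp_induct) (use * in \<open>auto intro: rtrancl_on_into_rtrancl_on\<close>)
qed

text \<open>
  Connectedness of a digraph refers to its symmetric closure, which is why \<open>E\<close> is compared
  with arcs in both directions.
\<close>

lemma connected_iff_connected_in:
  assumes "\<And>u v. u \<in> verts X \<Longrightarrow> v \<in> verts X \<Longrightarrow>
    E u v \<longleftrightarrow> (u, v) \<in> arcs_ends X \<or> (v, u) \<in> arcs_ends X"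
  shows "Digraph_Component.connected X \<longleftrightarrow> verts X \<noteq> {} \<and> connected_in (verts X) E"
proof -
  let ?R = "\<lambda>u v. (u, v) \<in> parcs (mk_symmetric X)"
  have "pverts (mk_symmetric X) = verts X" by (simp add: mk_symmetric_def)
  then have "Digraph_Component.connected X \<longleftrightarrow> verts X \<noteq> {} \<and> connected_in (verts X) ?R"
    by (auto simp: Digraph_Component.connected_def strongly_connected_def reachable_def
        rtrancl_on_iff_joined_in connected_in_def)
  moreover have "?R u v \<longleftrightarrow> (u, v) \<in> arcs_ends X \<or> (v, u) \<in> arcs_ends X" for u v
    by (auto simp: mk_symmetric_def arcs_ends_conv)
  then have "connected_in (verts X) ?R \<longleftrightarrow> connected_in (verts X) E"
    using assms by (intro connected_in_cong) simp
  ultimately show ?thesis by simp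
qed

lemma connected_induced_graph_of:
  assumes "graph_on n E" "S \<subseteq> {..<n}"
  shows "Digraph_Component.connected (with_proj (graph_of n E) \<restriction> S) \<longleftrightarrow> S \<noteq> {} \<and> connected_in S E"
proof -
  have "E v u" if "E u v" "u \<in> S" "v \<in> S" for u v
    using assms that unfolding graph_on_def by blast
  moreover have "u < n" if "u \<in> S" for u using that assms(2) by auto
  ultimately show ?thesis
    by (subst connected_iff_connected_in[where E = E])
      (auto simp: arcs_ends_conv induce_subgraph_def image_iff)
qed

lemma connected_graph_of:
  assumes "graph_on n E"
  shows "Digraph_Component.connected (with_proj (graph_of n E)) \<longleftrightarrow> 0 < n \<and> connected_in {..<n} E"
  using assms by (subst connected_iff_connected_in[where E = E]) (auto simp: graph_on_def)

lemma connected_in_mono: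
  assumes "connected_in S E" "\<And>x y. x \<in> S \<Longrightarrow> y \<in> S \<Longrightarrow> E x y \<Longrightarrow> E' x y"
  shows "connected_in S E'"
  unfolding connected_in_def
proof (intro ballI)
  fix u v assume uv: "u \<in> S" "v \<in> S"
  with assms(1) show "joined_in S E' u v"
    by (induction rule: connected_in_induct)
      (use assms(2) in \<open>auto intro: joined_in_refl joined_in_step\<close>)
qed

lemma thin_no_complete_minor:
  assumes "thin n t E"
  shows "\<not> has_minor (graph_of n E) (complete_graph (t + 1))"
proof
  assume "has_minor (graph_of n E) (complete_graph (t + 1))"
  then obtain M where
    M1: "\<forall>x\<in>{..<t + 1}. M x \<subseteq> {..<n} \<and>
      Digraph_Component.connected (with_proj (graph_of n E) \<restriction> M x)"
    and M2: "\<forall>x\<in>{..<t + 1}. \<forall>y\<in>{..<t + 1}. x \<noteq> y \<longrightarrow> M x \<inter> M y = {}"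
    and M3: "\<forall>(x, y)\<in>parcs (complete_graph (t + 1)). \<exists>u\<in>M x. \<exists>v\<in>M y. (u, v) \<in> parcs (graph_of n E)"
    unfolding has_minor_def by (auto simp: complete_graph_def)
  have M: "M x \<subseteq> {..<n}" "Digraph_Component.connected (with_proj (graph_of n E) \<restriction> M x)"
    if "x < t + 1" for x
    using M1 that by auto
  obtain H where H: "elimination n t H" "\<And>u v. u < n \<Longrightarrow> v < n \<Longrightarrow> E u v \<Longrightarrow> H u v"
    and E: "graph_on n E"
    using assms by (auto simp: thin_def)
  have "t + 1 \<le> t"
  proof (rule no_large_clique_minor[OF H(1)])
    fix x assume x: "x < t + 1"
    have "M x \<noteq> {}" "connected_in (M x) E"
      using connected_induced_graph_of[OF E M(1)[OF x]] M(2)[OF x] by auto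
    then show "M x \<noteq> {} \<and> M x \<subseteq> {..<n} \<and> connected_in (M x) H"
      using M(1)[OF x] H(2) by (auto elim!: connected_in_mono)
  next
    fix x y assume xy: "x < t + 1" "y < t + 1" "x \<noteq> y"
    then have "(x, y) \<in> parcs (complete_graph (t + 1))" by (simp add: complete_graph_def)
    then obtain u v where "u \<in> M x" "v \<in> M y" "u < n" "v < n" "E u v" using M3 by fastforce
    then show "M x \<inter> M y = {} \<and> (\<exists>u\<in>M x. \<exists>v\<in>M y. H u v)" using M2 xy H(2) by blast
  qed
  then show False by simp
qed

section \<open>Tree-width\<close>

lemma connected_in_rooted:
  assumes "\<And>v. v \<in> S \<Longrightarrow> joined_in S E v r" "\<And>x y. x \<in> S \<Longrightarrow> y \<in> S \<Longrightarrow> E x y \<Longrightarrow> E y x"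
  shows "connected_in S E"
  unfolding connected_in_def by (blast intro: joined_in_trans joined_in_sym assms)

text \<open>The tree in which each positive number is joined to its parent; \<open>0\<close> is the root.\<close>

definition tree_edge :: "(nat \<Rightarrow> nat) \<Rightarrow> nat \<Rightarrow> nat \<Rightarrow> bool" where
  "tree_edge par u v \<longleftrightarrow> 0 < v \<and> u = par v \<or> 0 < u \<and> v = par u"

lemma pcas_nth:
  assumes "pcas u p v" "p \<noteq> []"
  shows "fst (p ! 0) = u" "snd (p ! (length p - 1)) = v"
    and "Suc i < length p \<Longrightarrow> fst (p ! Suc i) = snd (p ! i)"
proof -
  have "fst (p ! 0) = u \<and> snd (p ! (length p - 1)) = v \<and>
      (\<forall>i. Suc i < length p \<longrightarrow> fst (p ! Suc i) = snd (p ! i))"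
    using assms
  proof (induction p arbitrary: u)
    case (Cons e es)
    show ?case
    proof (cases "es = []")
      case False
      then have IH: "fst (es ! 0) = snd e" "snd (es ! (length es - 1)) = v"
        "\<forall>i. Suc i < length es \<longrightarrow> fst (es ! Suc i) = snd (es ! i)"
        using Cons by auto
      then have "fst ((e # es) ! Suc i) = snd ((e # es) ! i)" if "Suc i < length (e # es)" for i
        using that by (cases i) auto
      then show ?thesis using IH Cons.prems False by (simp add: nth_Cons')
    qed (use Cons in auto)
  qed simp
  then show "fst (p ! 0) = u" "snd (p ! (length p - 1)) = v"
    and "Suc i < length p \<Longrightarrow> fst (p ! Suc i) = snd (p ! i)" by auto
qed

lemma pawalk_verts_eq: "pcas u p v \<Longrightarrow> pawalk_verts u p = u # map snd p"
  by (induction p arbitrary: u) auto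

text \<open>
  On a cycle of length at least three the largest vertex has two distinct smaller neighbours, but the
  only smaller neighbour of a vertex is its parent.
\<close>

lemma undirected_tree_par:
  assumes par: "\<And>v. 0 < v \<Longrightarrow> par v < v" and "0 < n"
  shows "undirected_tree (graph_of n (tree_edge par))"
proof -
  let ?T = "graph_of n (tree_edge par)"
  have g: "graph_on n (tree_edge par)"
    unfolding graph_on_def tree_edge_def using par by (metis less_irrefl)
  have "joined_in {..<n} (tree_edge par) v 0" if "v < n" for v
    using that
  proof (induction v rule: less_induct)
    case (less v)
    show ?case
    proof (cases "v = 0")
      case False
      then have "par v < v" using par by simp
      then have "joined_in {..<n} (tree_edge par) (par v) 0" using less by simp
      moreover have "joined_in {..<n} (tree_edge par) v (par v)"
        using less.prems False \<open>par v < v\<close> by (intro joined_in_edge) (auto simp: tree_edge_def)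
      ultimately show ?thesis by (rule joined_in_trans[rotated])
    qed (simp add: joined_in_refl)
  qed
  then have "connected_in {..<n} (tree_edge par)"
    by (rule connected_in_rooted[where r = 0]) (auto simp: tree_edge_def)
  moreover have "\<not> (pre_digraph.cycle (with_proj ?T) p \<and> 3 \<le> length p)" for p
  proof
    assume "pre_digraph.cycle (with_proj ?T) p \<and> 3 \<le> length p"
    then obtain u where p: "set p \<subseteq> parcs ?T" "pcas u p u" "distinct (map snd p)" "3 \<le> length p"
      by (auto simp: pre_digraph.cycle_def pre_digraph.awalk_def cas_with_proj_eq
          awalk_verts_with_proj_eq pawalk_verts_eq)
    let ?L = "length p"
    \<comment> \<open>The vertices of the cycle are the heads of its arcs; indices are read cyclically.\<close>
    define w where "w i = snd (p ! i)" for i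
    define prev where "prev i = (if i = 0 then ?L - 1 else i - 1)" for i
    define succ where "succ i = (if i = ?L - 1 then 0 else i + 1)" for i
    have "p \<noteq> []" using p by auto
    note nth = pcas_nth[OF p(2) this]
    have fst_w: "fst (p ! i) = w (prev i)" if "i < ?L" for i
      using nth(1,2) nth(3)[of "i - 1"] that by (cases i) (auto simp: prev_def w_def)
    have arc: "tree_edge par (w (prev i)) (w i)" "w i < n" if "i < ?L" for i
    proof -
      have "p ! i \<in> parcs ?T" using p(1) that by auto
      moreover have "p ! i = (w (prev i), w i)" using fst_w[OF that] by (simp add: w_def prod_eq_iff)
      ultimately show "tree_edge par (w (prev i)) (w i)" "w i < n" by auto
    qed
    have w_inj: "i = j" if "w i = w j" "i < ?L" "j < ?L" for i j
      using p(3) that by (auto simp: distinct_conv_nth w_def)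
    obtain i where i: "i < ?L" "\<And>j. j < ?L \<Longrightarrow> w j \<le> w i"
    proof -
      have "finite (w ` {..<?L})" "w ` {..<?L} \<noteq> {}" using \<open>p \<noteq> []\<close> by auto
      then have "Max (w ` {..<?L}) \<in> w ` {..<?L}" by (rule Max_in)
      then obtain i where "i < ?L" "w i = Max (w ` {..<?L})" by auto
      then show thesis using that[of i] by auto
    qed
    have idx: "prev i < ?L" "succ i < ?L" "prev (succ i) = i" "prev i \<noteq> succ i"
      "prev i \<noteq> i" "succ i \<noteq> i"
      using i(1) p(4) by (auto simp: prev_def succ_def)
    have lt: "w (prev i) < w i" "w (succ i) < w i"
      using i(2)[OF idx(1)] i(2)[OF idx(2)] w_inj[of "prev i" i] w_inj[of "succ i" i] idx i(1)
      by (auto simp: le_less)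
    have "a = par v" if "tree_edge par a v \<or> tree_edge par v a" "a < v" for a v
      using that par[of a] unfolding tree_edge_def by auto
    then have "w (prev i) = par (w i)" "w (succ i) = par (w i)"
      using arc(1)[OF i(1)] arc(1)[OF idx(2)] idx(3) lt by auto
    then show False using w_inj[of "prev i" "succ i"] idx by simp
  qed
  ultimately show ?thesis
    unfolding undirected_tree_def using pair_graph_graph_of[OF g] connected_graph_of[OF g] \<open>0 < n\<close>
    by blast
qed

text \<open>
  The bag of \<open>v\<close> is \<open>v\<close> with its earlier neighbours in \<open>H\<close>, and the parent of \<open>v\<close> is the latest of those.
  The bags containing \<open>v\<close> form a subtree rooted at \<open>v\<close>: if \<open>v\<close> is an earlier neighbour of \<open>x\<close>, then \<open>v\<close>
  and the parent of \<open>x\<close> belong to a common clique, so \<open>v\<close> lies in the bag of that parent as well.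
\<close>

lemma thin_tree_width:
  assumes "thin n s E" "0 < n"
  shows "tree_width (graph_of n E) \<le> s - 1"
proof -
  obtain H where H: "elimination n s H" "\<And>u v. u < n \<Longrightarrow> v < n \<Longrightarrow> E u v \<Longrightarrow> H u v"
    and E: "graph_on n E"
    using assms by (auto simp: thin_def)
  define par where "par v = (if earlier H v = {} then 0 else Max (earlier H v))" for v
  define B where "B v = insert v (earlier H v)" for v
  let ?T = "graph_of n (tree_edge par)"
  have par_in: "par v \<in> earlier H v" if "earlier H v \<noteq> {}" for v
    using that Max_in[of "earlier H v"] by (simp add: par_def)
  have par_ge: "u \<le> par v" if "u \<in> earlier H v" for u v
    using that Max_ge[of "earlier H v" u] by (auto simp: par_def)
  have par: "par v < v" if "0 < v" for v
    using that par_in[of v] by (cases "earlier H v = {}") (auto simp: par_def earlier_def)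
  have symT: "graph_on n (tree_edge par)"
    unfolding graph_on_def tree_edge_def using par by (metis less_irrefl)
  have cl: "clique H (earlier H v)" "card (earlier H v) < s" if "v < n" for v
    using H(1) that by (auto simp: elimination_def)
  have "tree_decomposition (graph_of n E) ?T B"
    unfolding tree_decomposition_def
  proof (intro conjI)
    show "undirected_tree ?T" using undirected_tree_par par assms by blast
    show "\<forall>x\<in>pverts ?T. B x \<subseteq> pverts (graph_of n E)" by (auto simp: B_def earlier_def)
    have "\<exists>x<n. u \<in> B x \<and> v \<in> B x" if uv: "u < n" "v < n" "E u v" for u v
    proof -
      have "H u v" "H v u" using H(2) uv E unfolding graph_on_def by blast+
      moreover have "u \<noteq> v" using uv E unfolding graph_on_def by blast
      ultimately show ?thesis
        using uv by (cases "u < v") (auto simp: B_def earlier_def)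
    qed
    then show "\<forall>(u, v)\<in>parcs (graph_of n E). \<exists>x\<in>pverts ?T. u \<in> B x \<and> v \<in> B x"
      by (auto simp: Bex_def)
    show "\<forall>v\<in>pverts (graph_of n E).
        Digraph_Component.connected (with_proj ?T \<restriction> {x \<in> pverts ?T. v \<in> B x})"
    proof
      fix v assume "v \<in> pverts (graph_of n E)"
      then have v: "v < n" by simp
      let ?S = "{x. x < n \<and> v \<in> B x}"
      have "joined_in ?S (tree_edge par) x v" if "x < n" "v \<in> B x" for x
        using that
      proof (induction x rule: less_induct)
        case (less x)
        show ?case
        proof (cases "x = v")
          case False
          then have vx: "v \<in> earlier H x" using less.prems by (simp add: B_def)
          then have p: "par x \<in> earlier H x" "v \<le> par x" using par_in par_ge by auto
          then have px: "par x < x" by (simp add: earlier_def)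
          have "v \<in> B (par x)"
            using cl(1)[OF less.prems(1)] vx p by (auto simp: B_def earlier_def clique_def)
          then have "joined_in ?S (tree_edge par) (par x) v" using less px by simp
          moreover have "joined_in ?S (tree_edge par) x (par x)"
            using less.prems px \<open>v \<in> B (par x)\<close> by (intro joined_in_edge) (auto simp: tree_edge_def)
          ultimately show ?thesis by (rule joined_in_trans[rotated])
        qed (simp add: joined_in_refl)
      qed
      then have "connected_in ?S (tree_edge par)"
        by (intro connected_in_rooted[where r = v]) (auto simp: tree_edge_def)
      moreover have "v \<in> ?S" using v by (simp add: B_def)
      ultimately show "Digraph_Component.connected (with_proj ?T \<restriction> {x \<in> pverts ?T. v \<in> B x})"
        using connected_induced_graph_of[OF symT, of ?S] by auto
    qed
  qed
  then have "tree_width (graph_of n E) \<le> decomposition_width ?T B"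
    unfolding tree_width_def by (intro Least_le) blast
  also have "\<dots> \<le> s - 1"
  proof -
    have "card (B x) \<le> s" if "x < n" for x
      using cl(2)[OF that] by (simp add: B_def card_insert_if)
    then have "Max ((\<lambda>x. card (B x)) ` pverts ?T) \<le> s"
      using assms(2) by (intro Max.boundedI) auto
    then show ?thesis unfolding decomposition_width_def by (rule diff_le_mono)
  qed
  finally show ?thesis .
qed

section \<open>Perfect quotients\<close>

lemma contains_complete_graphI:
  assumes G: "pair_loopfree_digraph G"
    and S: "S \<subseteq> pverts G" "finite S" "clique (\<lambda>u v. (u, v) \<in> parcs G) S"
  shows "contains_graph G (complete_graph (card S))"
proof -
  interpret pair_loopfree_digraph G by (rule G)
  let ?n = "card S"
  let ?K = "complete_graph ?n"
  define T where "T = \<lparr> pverts = S, parcs = {(u, v) \<in> parcs G. u \<in> S \<and> v \<in> S} \<rparr>"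
  have wfT: "pair_wf_digraph T" by unfold_locales (auto simp: T_def)
  have wfK: "pair_wf_digraph ?K" by unfold_locales (auto simp: complete_graph_def)
  have "induced_subgraph (with_proj T) (with_proj G)"
    using S(1) wfT pair_wf_digraph_axioms
    by (auto simp: induced_subgraph_def subgraph_def wf_digraph_wp_iff T_def)
  moreover obtain h where h: "bij_betw h {..<?n} S"
    using S(2) by (metis card_lessThan finite_lessThan finite_same_card_bij)
  let ?f = "\<lparr> iso_verts = h, iso_arcs = map_prod h h, iso_head = snd, iso_tail = fst \<rparr>"
  have inj: "inj_on h {..<?n}" and im: "h ` {..<?n} = S" using h by (auto simp: bij_betw_def)
  have arcs: "map_prod h h ` parcs ?K = parcs T"
  proof -
    have "parcs T = {(u, v). u \<in> S \<and> v \<in> S \<and> u \<noteq> v}"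
      using S(3) no_loops by (fastforce simp: T_def clique_def)
    also have "\<dots> = map_prod h h ` parcs ?K"
    proof (intro subset_antisym subsetI)
      fix e assume "e \<in> {(u, v). u \<in> S \<and> v \<in> S \<and> u \<noteq> v}"
      then obtain x y where e: "e = (x, y)" "x \<in> S" "y \<in> S" "x \<noteq> y" by auto
      then have "x \<in> h ` {..<?n}" "y \<in> h ` {..<?n}" by (simp_all only: im)
      then obtain i j where "i < ?n" "j < ?n" "x = h i" "y = h j" by (auto elim!: imageE)
      then have "i < ?n" "j < ?n" "e = (h i, h j)" "i \<noteq> j" using e by auto
      then show "e \<in> map_prod h h ` parcs ?K" by (auto simp: complete_graph_def)
    next
      fix e assume "e \<in> map_prod h h ` parcs ?K"
      then obtain i j where "i < ?n" "j < ?n" "e = (h i, h j)" "i \<noteq> j"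
        by (auto simp: complete_graph_def)
      then show "e \<in> {(u, v). u \<in> S \<and> v \<in> S \<and> u \<noteq> v}"
        using im inj by (auto simp: inj_on_def)
    qed
    finally show ?thesis by simp
  qed
  have "pre_digraph.digraph_isomorphism (with_proj ?K) ?f"
    unfolding pre_digraph.digraph_isomorphism_def
  proof (intro conjI)
    show "wf_digraph (with_proj ?K)" using wfK by (simp add: wf_digraph_wp_iff)
    show "inj_on (iso_verts ?f) (verts (with_proj ?K))" using inj by (simp add: complete_graph_def)
    have "inj_on (map_prod h h) ({..<?n} \<times> {..<?n})" using inj by (rule map_prod_inj_on) (rule inj)
    then show "inj_on (iso_arcs ?f) (arcs (with_proj ?K))"
      by (simp, elim inj_on_subset) (auto simp: complete_graph_def)
  qed auto
  moreover have "with_proj T = app_iso ?f (with_proj ?K)"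
    using im arcs by (simp add: app_iso_def with_proj_def) (simp add: T_def complete_graph_def)
  ultimately show ?thesis unfolding contains_graph_def digraph_iso_def by blast
qed

lemma contains_complete_graphD:
  assumes "contains_graph G (complete_graph n)"
  obtains h where "\<And>i. i < n \<Longrightarrow> h i \<in> pverts G"
    "\<And>i j. i < n \<Longrightarrow> j < n \<Longrightarrow> i \<noteq> j \<Longrightarrow> h i \<noteq> h j \<and> (h i, h j) \<in> parcs G"
proof -
  let ?K = "with_proj (complete_graph n)"
  obtain S f where S: "induced_subgraph (with_proj S) (with_proj G)"
    and f: "pre_digraph.digraph_isomorphism ?K f" "with_proj S = app_iso f ?K"
    using assms by (auto simp: contains_graph_def digraph_iso_def)
  let ?h = "iso_verts f"
  have eqs: "pverts S = ?h ` {..<n}" "parcs S = iso_arcs f ` parcs (complete_graph n)"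
    "fst = iso_tail f" "snd = iso_head f"
    using arg_cong[OF f(2), of verts] arg_cong[OF f(2), of arcs]
      arg_cong[OF f(2), of tail] arg_cong[OF f(2), of head]
    by (simp_all add: app_iso_def complete_graph_def)
  have sub: "pverts S \<subseteq> pverts G" "parcs S \<subseteq> parcs G"
    using S by (auto simp: induced_subgraph_def subgraph_def)
  have inj: "inj_on ?h {..<n}"
    using f(1) by (simp add: pre_digraph.digraph_isomorphism_def complete_graph_def)
  show thesis
  proof (rule that[of ?h])
    show "?h i \<in> pverts G" if "i < n" for i using that sub eqs by auto
    show "?h i \<noteq> ?h j \<and> (?h i, ?h j) \<in> parcs G" if ij: "i < n" "j < n" "i \<noteq> j" for i j
    proof
      show "?h i \<noteq> ?h j"
        using inj ij inj_on_eq_iff[of ?h "{..<n}" i j] by simp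
      have arc: "(i, j) \<in> parcs (complete_graph n)" using ij by (simp add: complete_graph_def)
      then have "?h i = iso_tail f (iso_arcs f (i, j))" "?h j = iso_head f (iso_arcs f (i, j))"
        using f(1) by (auto simp: pre_digraph.digraph_isomorphism_def)
      then have "iso_arcs f (i, j) = (?h i, ?h j)" using eqs(3,4) by (simp add: prod_eq_iff)
      then show "(?h i, ?h j) \<in> parcs G" using arc sub(2) eqs(2) by (metis image_eqI subsetD)
    qed
  qed
qed

lemma proper_colouring_exists:
  assumes "finite (pverts H)" "pair_loopfree_digraph H"
  shows "\<exists>c f. proper_colouring H c f"
proof -
  interpret pair_loopfree_digraph H by fact
  obtain f and n :: nat where f: "f ` pverts H = {i. i < n}" "inj_on f (pverts H)"
    using finite_imp_inj_to_nat_seg[OF assms(1)] by blast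
  have "f u \<noteq> f v" if "(u, v) \<in> parcs H" for u v
    using inj_on_eq_iff[OF f(2), of u v] that no_loops[of "(u, v)"] in_arcsD1[of u v] in_arcsD2[of u v]
    by simp
  then have "proper_colouring H n f" using f(1) by (auto simp: proper_colouring_def)
  then show ?thesis by blast
qed

text \<open>
  The five-cycle has no triangle, so its clique number is at most two, while an odd cycle has no
  proper colouring with two colours.
\<close>

lemma perfect_graph_no_pentagon:
  assumes Q: "pair_bidirected_digraph Q" "perfect_graph Q"
  shows "\<not> pentagon (\<lambda>x y. (x, y) \<in> parcs Q) a b c d e"
proof
  interpret pair_bidirected_digraph Q by fact
  assume pent: "pentagon (\<lambda>x y. (x, y) \<in> parcs Q) a b c d e"
  let ?V = "{a, b, c, d, e}"
  define H where "H = \<lparr> pverts = ?V, parcs = {(u, v) \<in> parcs Q. u \<in> ?V \<and> v \<in> ?V} \<rparr>"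
  have V: "?V \<subseteq> pverts Q" using pent in_arcsD1 unfolding pentagon_def by blast
  have H: "pair_loopfree_digraph H"
    by unfold_locales (use no_loops in \<open>auto simp: H_def\<close>)
  then interpret H: pair_loopfree_digraph H .
  have "induced_subgraph (with_proj H) (with_proj Q)"
    using V H.pair_wf_digraph_axioms pair_wf_digraph_axioms
    by (auto simp: induced_subgraph_def subgraph_def wf_digraph_wp_iff H_def)
  then have eq: "chromatic_number H = clique_number H"
    using Q(2) by (simp add: perfect_graph_def)
  have R: "(x, y) \<in> parcs Q \<longleftrightarrow> (y, x) \<in> parcs Q" for x y using arcs_symmetric by blast
  have irr: "(x, x) \<notin> parcs Q" for x using no_loops by fastforce
  have no_triangle: "n \<le> 2" if cont: "contains_graph H (complete_graph n)" for n
  proof (rule ccontr)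
    assume "\<not> n \<le> 2"
    then obtain h where h: "\<And>i. i < n \<Longrightarrow> h i \<in> pverts H"
      "\<And>i j. i < n \<Longrightarrow> j < n \<Longrightarrow> i \<noteq> j \<Longrightarrow> h i \<noteq> h j \<and> (h i, h j) \<in> parcs H"
      using contains_complete_graphD[OF cont] by blast
    define x y z where "x = h 0" and "y = h 1" and "z = h 2"
    have "x \<in> ?V" "y \<in> ?V" "z \<in> ?V" "(x, y) \<in> parcs Q" "(y, z) \<in> parcs Q" "(x, z) \<in> parcs Q"
      using h(1)[of 0] h(1)[of 1] h(1)[of 2] h(2)[of 0 1] h(2)[of 1 2] h(2)[of 0 2] \<open>\<not> n \<le> 2\<close>
      by (auto simp: x_def y_def z_def H_def)
    then show False using pent R irr unfolding pentagon_def by (elim insertE emptyE) metis+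
  qed
  have "{n. contains_graph H (complete_graph n)} \<subseteq> {..2}" using no_triangle by auto
  moreover have "contains_graph H (complete_graph 0)"
    using contains_complete_graphI[OF H, of "{}"] by (simp add: clique_def)
  ultimately have "clique_number H \<le> 2"
    unfolding clique_number_def by (subst Max_le_iff) (auto intro: finite_subset)
  moreover have "\<exists>f. proper_colouring H (chromatic_number H) f"
    unfolding chromatic_number_def
    by (rule LeastI_ex) (use proper_colouring_exists[OF _ H] in \<open>simp add: H_def\<close>)
  then obtain f where f: "proper_colouring H (chromatic_number H) f" by blast
  ultimately have two: "f x < 2" if "x \<in> ?V" for x
    using that eq by (fastforce simp: proper_colouring_def H_def)
  have "f x \<noteq> f y" if "(x, y) \<in> parcs Q" "x \<in> ?V" "y \<in> ?V" for x y
    using f that by (auto simp: proper_colouring_def H_def)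
  then have "f a \<noteq> f b" "f b \<noteq> f c" "f c \<noteq> f d" "f d \<noteq> f e" "f e \<noteq> f a"
    using pent by (auto simp: pentagon_def)
  then show False using two[of a] two[of b] two[of c] two[of d] two[of e] by auto
qed

text \<open>
  Labelling each vertex by its part turns the quotient graph into the quotient of a labelling.
\<close>

lemma perfect_partition_good_labelling:
  assumes E: "graph_on n E" and P: "perfect_partition \<P> (graph_of n E)"
  obtains f where "good_labelling {..<n} E f"
    "\<And>c. fibre {..<n} f c \<noteq> {} \<Longrightarrow> c \<in> \<P> \<and> fibre {..<n} f c = pverts c"
proof -
  let ?G = "graph_of n E"
  define f where "f v = (THE P. P \<in> \<P> \<and> v \<in> pverts P)" for v
  have part: "graph_partition \<P> ?G"
    and conn: "\<And>P. P \<in> \<P> \<Longrightarrow> Digraph_Component.connected (with_proj P)"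
    and perf: "perfect_graph (quotient_graph ?G \<P>)"
    using P by (auto simp: perfect_partition_def connected_partition_def)
  have ind: "pverts P \<subseteq> {..<n}" "parcs P = {(u, v) \<in> parcs ?G. u \<in> pverts P \<and> v \<in> pverts P}"
    if "P \<in> \<P>" for P
    using part that by (auto simp: graph_partition_def induced_subgraph_def subgraph_def)
  have f: "f v \<in> \<P>" "v \<in> pverts (f v)" if "v < n" for v
  proof -
    have "\<exists>!P. P \<in> \<P> \<and> v \<in> pverts P" using part that by (simp add: graph_partition_def)
    from theI'[OF this] show "f v \<in> \<P>" "v \<in> pverts (f v)" by (auto simp: f_def)
  qed
  have f_eq: "f v = P" if "P \<in> \<P>" "v \<in> pverts P" for v P
  proof -
    have "v < n" using ind that by blast
    then have "\<exists>!P. P \<in> \<P> \<and> v \<in> pverts P" using part by (simp add: graph_partition_def)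
    then show ?thesis using f[OF \<open>v < n\<close>] that by blast
  qed
  have fib: "fibre {..<n} f c = (if c \<in> \<P> then pverts c else {})" for c
  proof (intro set_eqI iffI)
    fix v assume "v \<in> fibre {..<n} f c"
    then show "v \<in> (if c \<in> \<P> then pverts c else {})" using f[of v] by (auto simp: fibre_def)
  next
    fix v assume "v \<in> (if c \<in> \<P> then pverts c else {})"
    then have v: "c \<in> \<P>" "v \<in> pverts c" by (auto split: if_splits)
    then show "v \<in> fibre {..<n} f c" using f_eq[OF v] ind(1)[OF v(1)] by (auto simp: fibre_def)
  qed
  have "connected_in (fibre {..<n} f c) E" for c
  proof (cases "c \<in> \<P>")
    case True
    have "E u v \<longleftrightarrow> (u, v) \<in> parcs c \<or> (v, u) \<in> parcs c" if "u \<in> pverts c" "v \<in> pverts c" for u v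
      using that ind[OF True] E unfolding graph_on_def by auto
    then show ?thesis
      using connected_iff_connected_in[of "with_proj c" E] conn[OF True] fib True by simp
  qed (simp add: fib connected_in_def)
  moreover have "\<not> pentagon (touches {..<n} E f) x1 x2 x3 x4 x5" for x1 x2 x3 x4 x5
  proof
    let ?Q = "quotient_graph ?G \<P>"
    assume *: "pentagon (touches {..<n} E f) x1 x2 x3 x4 x5"
    have "pair_bidirected_digraph ?Q"
    proof
      show "symmetric (with_proj ?Q)"
        using E by (fastforce simp: quotient_graph_def symmetric_def graph_on_def intro!: symI)
    qed (auto simp: quotient_graph_def)
    moreover have "pentagon (\<lambda>x y. (x, y) \<in> parcs ?Q) x1 x2 x3 x4 x5"
      using *
    proof (rule pentagon_transfer[where L = \<P>])
      show "x \<in> \<P> \<and> y \<in> \<P>" if "touches {..<n} E f x y" for x y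
        using that fib by (auto simp: touches_def split: if_splits)
      show "(x, y) \<in> parcs ?Q \<longleftrightarrow> touches {..<n} E f x y" if "x \<in> \<P>" "y \<in> \<P>" "x \<noteq> y" for x y
        using that ind(1) by (fastforce simp: quotient_graph_def touches_def fib)
    qed
    ultimately show False using perfect_graph_no_pentagon[OF _ perf] by metis
  qed
  ultimately have "good_labelling {..<n} E f" by (auto simp: good_labelling_def)
  moreover have "c \<in> \<P> \<and> fibre {..<n} f c = pverts c" if "fibre {..<n} f c \<noteq> {}" for c
    using that fib by (auto split: if_splits)
  ultimately show thesis using that by blast
qed

lemma forces_clique_in_part:
  assumes E: "graph_on n E" and "forces_clique k n E" "1 \<le> k"
    and P: "perfect_partition \<P> (graph_of n E)"
  shows "\<exists>P\<in>\<P>. contains_graph P (complete_graph k)"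
proof -
  obtain f where f: "good_labelling {..<n} E f"
    "\<And>c. fibre {..<n} f c \<noteq> {} \<Longrightarrow> c \<in> \<P> \<and> fibre {..<n} f c = pverts c"
    using perfect_partition_good_labelling[OF E P] by blast
  then obtain c S where S: "S \<subseteq> fibre {..<n} f c" "clique E S" "card S = k"
    using assms(2) unfolding forces_clique_def mono_clique_def by blast
  have "S \<noteq> {}" "finite S" using S(3) assms(3) by (auto intro: card_ge_0_finite)
  then have c: "c \<in> \<P>" "S \<subseteq> pverts c" using f(2)[of c] S(1) by auto
  then have ind: "induced_subgraph (with_proj c) (with_proj (graph_of n E))"
    using P by (auto simp: perfect_partition_def connected_partition_def graph_partition_def)
  then have arcs: "parcs c = {e \<in> parcs (graph_of n E). fst e \<in> pverts c \<and> snd e \<in> pverts c}"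
    by (simp add: induced_subgraph_def)
  have "pair_loopfree_digraph c"
    unfolding pair_loopfree_digraph_def pair_loopfree_digraph_axioms_def pair_wf_digraph_def arcs
    using E by (auto simp: graph_on_def)
  moreover have "clique (\<lambda>u v. (u, v) \<in> parcs c) S"
  proof -
    have "u < n" if "u \<in> S" for u using that S(1) by (auto simp: fibre_def)
    then show ?thesis using S(2) c(2) by (auto simp: clique_def arcs)
  qed
  ultimately have "contains_graph c (complete_graph k)"
    using contains_complete_graphI[of c S] c(2) \<open>finite S\<close> S(3) by simp
  then show ?thesis using c(1) by blast
qed

section \<open>Large cliques in the parts of perfect partitions\<close>

theorem theorem3:
  shows "(\<forall>k::nat. 1 \<le> k \<longrightarrow>
            (\<exists>G :: nat pair_pre_digraph. pair_graph G \<and>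
               (\<forall>\<P>. perfect_partition \<P> G \<longrightarrow>
                  (\<exists>P\<in>\<P>. contains_graph P (complete_graph k))))) \<and>
         (\<forall>t::nat. 6 \<le> t \<longrightarrow>
            (\<exists>G :: nat pair_pre_digraph. pair_graph G \<and>
               tree_width G \<le> t - 1 \<and>
               \<not> has_minor G (complete_graph (t + 1)) \<and>
               (\<forall>\<P>. perfect_partition \<P> G \<longrightarrow>
                  (\<exists>P\<in>\<P>. \<exists>n::nat. \<lfloor>(3 / 2 * real t - 8) powr (1 / 3)\<rfloor> \<le> int n \<and>
                     contains_graph P (complete_graph n)))))"
proof (intro conjI allI impI)
  fix k :: nat assume "1 \<le> k"
  obtain n s E where "thin n s E" "forces_clique k n E" using clique_forcing_graph by blast
  then have "graph_on n E" by (simp add: thin_def)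
  then show "\<exists>G :: nat pair_pre_digraph. pair_graph G \<and>
      (\<forall>\<P>. perfect_partition \<P> G \<longrightarrow> (\<exists>P\<in>\<P>. contains_graph P (complete_graph k)))"
    using pair_graph_graph_of forces_clique_in_part \<open>forces_clique k n E\<close> \<open>1 \<le> k\<close> by blast
next
  fix t :: nat assume t: "6 \<le> t"
  \<comment> \<open>The condition \<open>6 \<le> t\<close> makes the cube root at least 1, so that \<open>k\<close> is positive.\<close>
  let ?x = "3 / 2 * real t - 8"
  define k where "k = nat \<lfloor>?x powr (1 / 3)\<rfloor>"
  have x: "1 \<le> ?x" using t by simp
  then have "1 \<le> ?x powr (1 / 3)" by (simp add: ge_one_powr_ge_zero)
  then have floor: "1 \<le> \<lfloor>?x powr (1 / 3)\<rfloor>" by simp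
  then have k: "1 \<le> k" "int k = \<lfloor>?x powr (1 / 3)\<rfloor>" unfolding k_def by linarith+
  have "real k \<le> ?x powr (1 / 3)" using k(2) by linarith
  then have "real k ^ 3 \<le> (?x powr (1 / 3)) ^ 3" by (rule power_mono) simp
  also have "\<dots> = ?x" using x by (simp flip: powr_realpow add: powr_powr)
  finally have "2 * real (k ^ 3) + 16 \<le> 3 * real t" by simp
  then have kt: "2 * k ^ 3 + 16 \<le> 3 * t" by linarith
  obtain n s E where thin: "thin n s E" and forces: "forces_clique k n E"
    and "3 * s \<le> 2 * k ^ 3 + 16"
    using clique_forcing_graph by blast
  then have "s \<le> t" using kt by linarith
  then have thin_t: "thin n t E" using thin thin_mono by blast
  have E: "graph_on n E" using thin by (simp add: thin_def)
  \<comment> \<open>The decomposition tree has the vertices of the graph as nodes, and a tree is non-empty.\<close>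
  have "0 < n"
  proof (rule ccontr)
    assume "\<not> 0 < n"
    then have "good_labelling {..<n} E (\<lambda>_. undefined)"
      by (simp add: good_labelling_def fibre_def connected_in_def touches_def pentagon_def)
    then show False
      using forces \<open>\<not> 0 < n\<close> k(1) unfolding forces_clique_def mono_clique_def fibre_def by auto
  qed
  show "\<exists>G :: nat pair_pre_digraph. pair_graph G \<and>
      tree_width G \<le> t - 1 \<and>
      \<not> has_minor G (complete_graph (t + 1)) \<and>
      (\<forall>\<P>. perfect_partition \<P> G \<longrightarrow>
         (\<exists>P\<in>\<P>. \<exists>n::nat. \<lfloor>?x powr (1 / 3)\<rfloor> \<le> int n \<and> contains_graph P (complete_graph n)))"
    using pair_graph_graph_of[OF E] thin_tree_width[OF thin_t \<open>0 < n\<close>]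
      thin_no_complete_minor[OF thin_t] forces_clique_in_part[OF E forces k(1)] k(2)
    by (intro exI[of _ "graph_of n E"] conjI allI impI) (metis order_refl)+
qed

end
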